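(* For constrained delegation with laminar signals there is a polynomial-time algorithm to compute an optimal decision scheme $\psi^*$.
   Context: Constrained delegation. An instance consists of a finite set $\Theta$ of states partitioned as $\Theta=\Theta_A\sqcup\Theta_R$ (acceptable and rejectable states), a finite set $\Sigma$ of signals, rational probabilities $q_\theta>0$ with $\sum_\theta q_\theta=1$, and a bipartite graph $H=(\Theta\cup\Sigma,E)$, $E\subseteq\Theta\times\Sigma$, without isolated vertices; $(\theta,\sigma)\in E$ means that $\sigma$ may be sent in state $\theta$, and $N(\cdot)$ denotes neighborhoods. The receiver commits to a decision scheme $\psi:\Sigma\to[0,1]$, where $\psi(\sigma)$ is the probability of accepting upon signal $\sigma$. In state $\theta$ the sender then sends a signal in $N(\theta)$ maximizing the acceptance probability. The receiver gets $1$ for accepting in a state of $\Theta_A$ or rejecting in a state of $\Theta_R$, and $0$ otherwise, so her utility is $$U_r(\psi)=\sum_{\theta\in\Theta_A}q_\theta\max_{\sigma\in N(\theta)}\psi(\sigma)+\sum_{\theta\in\Theta_R}q_\theta\Big(1-\max_{\sigma\in N(\theta)}\psi(\sigma)\Big).$$ An optimal decision scheme $\psi^*$ maximizes $U_r$. Laminar signals: the family $\{N(\theta)\mid\theta\in\Theta\}$ of subsets of $\Sigma$ is laminar, i.e., any two of its members are either disjoint or one contains the other. *)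

theory Defs
  imports
    Complex_Main
    "HOL-Library.Log_Nat"
    "HOL-Computational_Algebra.Polynomial"
begin

section \<open>Constrained delegation\<close>

record ('a, 'b) delegation =
  acceptable :: "'a set"
  rejectable :: "'a set"
  signals :: "'b set"
  prob :: "'a \<Rightarrow> rat"
  edges :: "('a \<times> 'b) set"

definition states :: "('a, 'b) delegation \<Rightarrow> 'a set" where
  "states I = acceptable I \<union> rejectable I"

definition nbhd :: "('a, 'b) delegation \<Rightarrow> 'a \<Rightarrow> 'b set" where
  "nbhd I \<theta> = edges I `` {\<theta>}"

definition delegation_instance :: "('a, 'b) delegation \<Rightarrow> bool" where
  "delegation_instance I \<longleftrightarrow>
     finite (states I) \<and> acceptable I \<inter> rejectable I = {} \<and> finite (signals I) \<and>
     (\<forall>\<theta>\<in>states I. prob I \<theta> > 0) \<and> (\<Sum>\<theta>\<in>states I. prob I \<theta>) = 1 \<and>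
     edges I \<subseteq> states I \<times> signals I \<and>
     (\<forall>\<theta>\<in>states I. \<exists>\<sigma>. (\<theta>, \<sigma>) \<in> edges I) \<and>
     (\<forall>\<sigma>\<in>signals I. \<exists>\<theta>. (\<theta>, \<sigma>) \<in> edges I)"

definition laminar :: "'b set set \<Rightarrow> bool" where
  "laminar F \<longleftrightarrow> (\<forall>A\<in>F. \<forall>B\<in>F. A \<inter> B = {} \<or> A \<subseteq> B \<or> B \<subseteq> A)"

definition decision_scheme :: "('a, 'b) delegation \<Rightarrow> ('b \<Rightarrow> real) \<Rightarrow> bool" where
  "decision_scheme I \<psi> \<longleftrightarrow> (\<forall>\<sigma>\<in>signals I. 0 \<le> \<psi> \<sigma> \<and> \<psi> \<sigma> \<le> 1)"

definition receiver_utility :: "('a, 'b) delegation \<Rightarrow> ('b \<Rightarrow> real) \<Rightarrow> real" where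
  "receiver_utility I \<psi> =
     (\<Sum>\<theta>\<in>acceptable I. of_rat (prob I \<theta>) * Max (\<psi> ` nbhd I \<theta>)) +
     (\<Sum>\<theta>\<in>rejectable I. of_rat (prob I \<theta>) * (1 - Max (\<psi> ` nbhd I \<theta>)))"

definition optimal_scheme :: "('a, 'b) delegation \<Rightarrow> ('b \<Rightarrow> real) \<Rightarrow> bool" where
  "optimal_scheme I \<psi> \<longleftrightarrow> decision_scheme I \<psi> \<and>
     (\<forall>\<phi>. decision_scheme I \<phi> \<longrightarrow> receiver_utility I \<phi> \<le> receiver_utility I \<psi>)"


section \<open>Random access machines with logarithmic cost\<close>

text \<open>
  Algorithms are programs of a random access machine over the integers, charged by the
  logarithmic cost criterion: every access to a register or memory cell costs the bit length
  of its address plus the bit length of its content. With this criterion polynomial time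
  agrees with polynomial time on Turing machines, also in the presence of multiplication and
  division as single instructions. A program uses finitely many directly addressed registers
  and an unbounded memory, which is addressed indirectly through registers. Control flow is
  structured (conditionals and loops instead of jumps).
\<close>

datatype arith = Add | Sub | Mul | Div

text \<open>Division rounds down, and division by zero yields zero.\<close>

fun arith_val :: "arith \<Rightarrow> int \<Rightarrow> int \<Rightarrow> int" where
  "arith_val Add x y = x + y"
| "arith_val Sub x y = x - y"
| "arith_val Mul x y = x * y"
| "arith_val Div x y = x div y"

datatype com =
    Skip
  | Const nat int             \<comment> \<open>\<open>R[i] := k\<close>\<close>
  | Arith arith nat nat nat   \<comment> \<open>\<open>R[i] := R[j] op R[k]\<close>\<close>
  | Load nat nat              \<comment> \<open>\<open>R[i] := M[R[j]]\<close>\<close>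
  | Store nat nat             \<comment> \<open>\<open>M[R[i]] := R[j]\<close>\<close>
  | Seq com com
  | IfPos nat com com         \<comment> \<open>tests \<open>R[i] > 0\<close>\<close>
  | WhilePos nat com

type_synonym store = "nat \<Rightarrow> int"

text \<open>The bit length of an integer includes a sign bit, so it is at least one.\<close>

definition bits :: "int \<Rightarrow> nat" where
  "bits x = 1 + floorlog 2 (nat \<bar>x\<bar>)"

definition cell_cost :: "nat \<Rightarrow> int \<Rightarrow> nat" where
  "cell_cost a x = bits (int a) + bits x"

text \<open>
  \<open>exec c (R, M) t (R', M')\<close>: started with registers \<open>R\<close> and memory \<open>M\<close>, the program \<open>c\<close>
  terminates with \<open>R'\<close> and \<open>M'\<close> at total cost \<open>t\<close>. A program that uses a negative number as
  a memory address is stuck.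
\<close>

inductive exec :: "com \<Rightarrow> store \<times> store \<Rightarrow> nat \<Rightarrow> store \<times> store \<Rightarrow> bool" where
  Skip: "exec Skip s 1 s"
| Const: "exec (Const i k) (R, M) (cell_cost i k) (R(i := k), M)"
| Arith: "x = arith_val f (R j) (R k) \<Longrightarrow>
    exec (Arith f i j k) (R, M)
      (cell_cost j (R j) + cell_cost k (R k) + cell_cost i x) (R(i := x), M)"
| Load: "R j = int a \<Longrightarrow>
    exec (Load i j) (R, M)
      (cell_cost j (R j) + cell_cost a (M a) + cell_cost i (M a)) (R(i := M a), M)"
| Store: "R i = int a \<Longrightarrow>
    exec (Store i j) (R, M)
      (cell_cost i (R i) + cell_cost j (R j) + cell_cost a (R j)) (R, M(a := R j))"
| Seq: "exec c s t s' \<Longrightarrow> exec d s' u s'' \<Longrightarrow> exec (Seq c d) s (t + u) s''"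
| IfTrue: "R i > 0 \<Longrightarrow> exec c (R, M) t s \<Longrightarrow>
    exec (IfPos i c d) (R, M) (cell_cost i (R i) + t) s"
| IfFalse: "R i \<le> 0 \<Longrightarrow> exec d (R, M) t s \<Longrightarrow>
    exec (IfPos i c d) (R, M) (cell_cost i (R i) + t) s"
| WhileTrue: "R i > 0 \<Longrightarrow> exec c (R, M) t s' \<Longrightarrow> exec (WhilePos i c) s' u s'' \<Longrightarrow>
    exec (WhilePos i c) (R, M) (cell_cost i (R i) + t + u) s''"
| WhileFalse: "R i \<le> 0 \<Longrightarrow>
    exec (WhilePos i c) (R, M) (cell_cost i (R i)) (R, M)"

inductive_cases SkipE: "exec Skip s t s'"
inductive_cases ConstE: "exec (Const i k) s t s'"
inductive_cases ArithE: "exec (Arith f i j k) s t s'"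
inductive_cases LoadE: "exec (Load i j) s t s'"
inductive_cases StoreE: "exec (Store i j) s t s'"
inductive_cases SeqE: "exec (Seq c d) s t s'"
inductive_cases IfE: "exec (IfPos i c d) s t s'"
inductive_cases WhileE: "exec (WhilePos i c) s t s'"

lemma exec_deterministic:
  "exec c s t s' \<Longrightarrow> exec c s u s'' \<Longrightarrow> u = t \<and> s'' = s'"
proof (induction arbitrary: u s'' rule: exec.induct)
  case (Seq c s t s' d v s1)
  from Seq.prems obtain t' v' r where "u = t' + v'" "exec c s t' r" "exec d r v' s''"
    by (rule SeqE)
  with Seq.IH show ?case by metis
next
  case (IfTrue R i c M t s d)
  from IfTrue.prems IfTrue.hyps obtain t' where
    "u = cell_cost i (R i) + t'" "exec c (R, M) t' s''"
    by (cases rule: IfE) auto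
  with IfTrue.IH show ?case by metis
next
  case (IfFalse R i d M t s c)
  from IfFalse.prems IfFalse.hyps obtain t' where
    "u = cell_cost i (R i) + t'" "exec d (R, M) t' s''"
    by (cases rule: IfE) auto
  with IfFalse.IH show ?case by metis
next
  case (WhileTrue R i c M t s' v s1)
  from WhileTrue.prems WhileTrue.hyps obtain t' v' r where
    "u = cell_cost i (R i) + t' + v'" "exec c (R, M) t' r" "exec (WhilePos i c) r v' s''"
    by (cases rule: WhileE) auto
  with WhileTrue.IH show ?case by metis
next
  case (WhileFalse R i c M)
  from WhileFalse.prems WhileFalse.hyps show ?case by (cases rule: WhileE) auto
qed (auto elim: SkipE ConstE ArithE LoadE StoreE)

text \<open>
  A finite sequence of integers is passed to and returned by a program in the first memory
  cells, its length in register 0. Initially, all other registers and cells are zero.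
\<close>

definition input_state :: "int list \<Rightarrow> store \<times> store" where
  "input_state xs =
     ((\<lambda>_. 0)(0 := int (length xs)), (\<lambda>a. if a < length xs then xs ! a else 0))"

definition output_of :: "store \<times> store \<Rightarrow> int list" where
  "output_of = (\<lambda>(R, M). map M [0..<nat (R 0)])"

definition input_size :: "int list \<Rightarrow> nat" where
  "input_size xs = (\<Sum>x\<leftarrow>xs. bits x)"

text \<open>
  A computational problem is given by a set \<open>D\<close> of admissible instances, an encoding of them,
  and the relation between instances and encodings of their solutions.
\<close>

definition polytime_solvable ::
  "'i set \<Rightarrow> ('i \<Rightarrow> int list) \<Rightarrow> ('i \<Rightarrow> int list \<Rightarrow> bool) \<Rightarrow> bool" where
  "polytime_solvable D enc sol \<longleftrightarrow>
     (\<exists>(c :: com) (p :: nat poly). \<forall>I\<in>D. \<exists>t s.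
        exec c (input_state (enc I)) t s \<and>
        t \<le> poly p (input_size (enc I)) \<and>
        sol I (output_of s))"


section \<open>Encoding of instances and solutions\<close>

text \<open>
  To be presented to a machine, the \<open>n\<close> states and the \<open>m\<close> signals are numbered by
  \<open>0, \<dots>, n - 1\<close> and \<open>0, \<dots>, m - 1\<close>, in an arbitrary way. An instance is encoded by \<open>n\<close> and \<open>m\<close>,
  followed for every state by a flag for acceptability and its probability as a reduced
  fraction, followed by the adjacency matrix of the graph, row by row.
\<close>

definition numbered :: "(nat, nat) delegation \<Rightarrow> bool" where
  "numbered I \<longleftrightarrow>
     states I = {..<card (states I)} \<and> signals I = {..<card (signals I)}"

definition encode_rat :: "rat \<Rightarrow> int list" where
  "encode_rat r = (case quotient_of r of (a, b) \<Rightarrow> [a, b])"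

definition encode_instance :: "(nat, nat) delegation \<Rightarrow> int list" where
  "encode_instance I =
     (let n = card (states I); m = card (signals I) in
        [int n, int m] @
        concat (map (\<lambda>\<theta>. of_bool (\<theta> \<in> acceptable I) # encode_rat (prob I \<theta>)) [0..<n]) @
        concat (map (\<lambda>\<theta>. map (\<lambda>\<sigma>. of_bool ((\<theta>, \<sigma>) \<in> edges I)) [0..<m]) [0..<n]))"

definition encode_scheme :: "(nat, nat) delegation \<Rightarrow> (nat \<Rightarrow> rat) \<Rightarrow> int list" where
  "encode_scheme I \<psi> = concat (map (\<lambda>\<sigma>. encode_rat (\<psi> \<sigma>)) [0..<card (signals I)])"

text \<open>
  The output has to encode a rational decision scheme which is optimal among all real-valued
  decision schemes.
\<close>

definition encodes_optimal_scheme :: "(nat, nat) delegation \<Rightarrow> int list \<Rightarrow> bool" where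
  "encodes_optimal_scheme I ys \<longleftrightarrow>
     (\<exists>\<psi>. optimal_scheme I (\<lambda>\<sigma>. of_rat (\<psi> \<sigma>)) \<and> ys = encode_scheme I \<psi>)"

end

theory Submission
  imports Defs
begin

text \<open>
  For every decision scheme \<open>\<psi>\<close> the utility of the receiver is, up to a constant, the sum of
  \<open>\<plusminus> q\<^sub>\<theta>\<close> times the maximum of \<open>\<psi>\<close> on the neighbourhood of \<open>\<theta>\<close>. If the neighbourhoods are laminar,
  the states are processed by increasing size of the neighbourhood. At each time the signals are
  partitioned into components: the maximal neighbourhoods processed so far and singletons. For each
  component a best nonempty set of accepted signals and its value are stored. When a neighbourhood
  absorbs some components, its best nonempty set consists of the stored sets of positive value among
  them or, if there is none, of one stored set of largest value. At the end the stored sets of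
  positive value are accepted.

  The same values bound every scheme with values in \<open>[0, 1]\<close>, because the value of a component
  may be scaled by the maximum of \<open>\<psi>\<close> on it. With the product of all denominators as common
  denominator the algorithm only handles integers of linear bit length.
\<close>

section \<open>Expressions, loops and cost bounds for the machine\<close>

text \<open>Emptiness is left open until the end: the weight of \<theta> is incurred as soon as any
  signal of \<open>N \<theta>\<close> is accepted, so the best nonempty set of a component may have
  negative value and must still be remembered, since a larger acceptable neighbourhood can later
  lift that value above 0. Taking neighbourhoods by size is what makes laminarity useful: each one
  still to come is a union of current components, so only the components hit matter. The invariant
  is two-sided: stored values are attained exactly, simultaneously for every collection of
  components, and they bound all real schemes. The bound is stated for all nonnegative \<psi>; it is
  linear in the maxima over components, so it keeps its form under a merge, and over [0, 1] its
  right-hand side is largest at maxima 0 or 1. Hence a deterministic scheme is optimal. Every stored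
  value is the net weight of a set of states, which limits its modulus. The running time splits
  accordingly: one number \<open>B\<close> bounds all contents and addresses, and a separate count
  of instructions depends only on a bound for the loops.\<close>

datatype exp = Num int | Var nat | Mem exp | Bin arith exp exp

primrec exp_val :: "exp \<Rightarrow> store \<Rightarrow> store \<Rightarrow> int" where
  "exp_val (Num k) V M = k"
| "exp_val (Var i) V M = V i"
| "exp_val (Mem e) V M = M (nat (exp_val e V M))"
| "exp_val (Bin f e1 e2) V M = arith_val f (exp_val e1 V M) (exp_val e2 V M)"

text \<open>The scratch registers form an evaluation stack. This is how far above its target
  register an expression reaches, as the right operand is computed one register higher while the
  left value waits.\<close>

primrec height :: "exp \<Rightarrow> nat" where
  "height (Num k) = 0"
| "height (Var i) = 0"
| "height (Mem e) = height e"
| "height (Bin f e1 e2) = max (height e1) (Suc (height e2))"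

abbreviation scratch :: nat where "scratch \<equiv> 20"

text \<open>Excludes an intermediate result larger than \<open>B\<close>, which would break the cost
  bound, and a negative address, which would leave the machine stuck. Contents of registers and
  cells are covered by \<open>bounded\<close>.\<close>

primrec safe :: "int \<Rightarrow> exp \<Rightarrow> store \<Rightarrow> store \<Rightarrow> bool" where
  "safe B (Num k) V M \<longleftrightarrow> \<bar>k\<bar> \<le> B"
| "safe B (Var i) V M \<longleftrightarrow> i < scratch"
| "safe B (Mem e) V M \<longleftrightarrow> safe B e V M \<and> 0 \<le> exp_val e V M"
| "safe B (Bin f e1 e2) V M \<longleftrightarrow> safe B e1 V M \<and> safe B e2 V M \<and>
     \<bar>arith_val f (exp_val e1 V M) (exp_val e2 V M)\<bar> \<le> B"

text \<open>The machine has no copy instruction, so a variable is copied by adding it to 0.\<close>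

primrec eval_to :: "exp \<Rightarrow> nat \<Rightarrow> com" where
  "eval_to (Num k) d = Const d k"
| "eval_to (Var i) d = Seq (Const d 0) (Arith Add d i d)"
| "eval_to (Mem e) d = Seq (eval_to e d) (Load d d)"
| "eval_to (Bin f e1 e2) d =
     Seq (eval_to e1 d) (Seq (eval_to e2 (Suc d)) (Arith f d d (Suc d)))"

definition assign :: "nat \<Rightarrow> exp \<Rightarrow> com" where
  "assign x e = Seq (eval_to e scratch) (Seq (Const (Suc scratch) 0) (Arith Add x scratch (Suc scratch)))"

definition mem_write :: "exp \<Rightarrow> exp \<Rightarrow> com" where
  "mem_write e1 e2 = Seq (eval_to e1 scratch) (Seq (eval_to e2 (Suc scratch)) (Store scratch (Suc scratch)))"

definition if_pos :: "exp \<Rightarrow> com \<Rightarrow> com \<Rightarrow> com" where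
  "if_pos e c d = Seq (eval_to e scratch) (IfPos scratch c d)"

definition if_eq :: "exp \<Rightarrow> exp \<Rightarrow> com \<Rightarrow> com \<Rightarrow> com" where
  "if_eq e1 e2 c d = if_pos (Bin Sub e1 e2) d (if_pos (Bin Sub e2 e1) d c)"

text \<open>The loop test is the remaining distance from \<open>x\<close> to \<open>y\<close>. It is
  recomputed after every round because the body uses the scratch registers itself.\<close>

definition for_upto :: "nat \<Rightarrow> nat \<Rightarrow> com \<Rightarrow> com" where
  "for_upto x y c =
     (let d = eval_to (Bin Sub (Var y) (Var x)) scratch in
      Seq (Seq (assign x (Num 0)) d)
        (WhilePos scratch (Seq (Seq c (assign x (Bin Add (Var x) (Num 1)))) d)))"

text \<open>An upper bound for the number of executed instructions if no loop takes more than \<open>N\<close> rounds.\<close>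

primrec steps :: "nat \<Rightarrow> com \<Rightarrow> nat" where
  "steps N Skip = 1"
| "steps N (Const i k) = 1"
| "steps N (Arith f i j k) = 1"
| "steps N (Load i j) = 1"
| "steps N (Store i j) = 1"
| "steps N (Seq c d) = steps N c + steps N d"
| "steps N (IfPos i c d) = 1 + steps N c + steps N d"
| "steps N (WhilePos i c) = 1 + N * (1 + steps N c)"

text \<open>Each loop contributes one factor \<open>N\<close>, so the degree is governed by the
  nesting depth of the loops, which is fixed with the program.\<close>

lemma steps_poly: "\<exists>p. \<forall>N. steps N c = poly p N"
proof (induction c)
  case (Seq c d)
  then obtain p q where "\<forall>N. steps N c = poly p N" "\<forall>N. steps N d = poly q N" by blast
  then show ?case by (intro exI[of _ "p + q"]) simp
next
  case (IfPos i c d)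
  then obtain p q where "\<forall>N. steps N c = poly p N" "\<forall>N. steps N d = poly q N" by blast
  then show ?case by (intro exI[of _ "1 + p + q"]) simp
next
  case (WhilePos i c)
  then obtain p where "\<forall>N. steps N c = poly p N" by blast
  then show ?case by (intro exI[of _ "1 + [:0, 1:] * (1 + p)"]) simp
qed (auto intro: exI[of _ 1])

section \<open>Logarithmic cost of single instructions\<close>

lemma bits_mono: "\<bar>x\<bar> \<le> \<bar>y\<bar> \<Longrightarrow> bits x \<le> bits y"
  unfolding bits_def by (simp add: floorlog_mono nat_mono)

definition bounded :: "int \<Rightarrow> store \<Rightarrow> store \<Rightarrow> bool" where
  "bounded B R M \<longleftrightarrow> (\<forall>i. \<bar>R i\<bar> \<le> B) \<and> (\<forall>a. \<bar>M a\<bar> \<le> B)"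

lemma bounded_upd:
  "bounded B R M \<Longrightarrow> \<bar>x\<bar> \<le> B \<Longrightarrow> bounded B (R(i := x)) M"
  "bounded B R M \<Longrightarrow> \<bar>x\<bar> \<le> B \<Longrightarrow> bounded B R (M(i := x))"
  by (auto simp: bounded_def)

lemma boundedD:
  "bounded B R M \<Longrightarrow> \<bar>R i\<bar> \<le> B"
  "bounded B R M \<Longrightarrow> \<bar>M a\<bar> \<le> B"
  by (auto simp: bounded_def)

lemma cell_cost_le: "int a \<le> B \<Longrightarrow> \<bar>x\<bar> \<le> B \<Longrightarrow> cell_cost a x \<le> 2 * bits B"
  unfolding cell_cost_def using bits_mono[of "int a" B] bits_mono[of x B] by simp

text \<open>
  The unit cost of an instruction stands for at most three cell accesses, each of which is
  charged for an address and a content.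
\<close>

definition runs :: "int \<Rightarrow> com \<Rightarrow> store \<times> store \<Rightarrow> nat \<Rightarrow> store \<times> store \<Rightarrow> bool" where
  "runs B c s k s' \<longleftrightarrow> case_prod (bounded B) s' \<and> (\<exists>t. exec c s t s' \<and> t \<le> k * (6 * bits B))"

lemma runs_bounded: "runs B c s k (R, M) \<Longrightarrow> bounded B R M"
  by (simp add: runs_def)

lemma runs_mono: "runs B c s k s' \<Longrightarrow> k \<le> l \<Longrightarrow> runs B c s l s'"
  unfolding runs_def by (meson le_trans mult_le_mono1)

lemma runs_Const:
  "bounded B R M \<Longrightarrow> int i \<le> B \<Longrightarrow> \<bar>k\<bar> \<le> B \<Longrightarrow> runs B (Const i k) (R, M) (Suc 0) (R(i := k), M)"
  unfolding runs_def using cell_cost_le[of i B k]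
  by (auto intro!: bounded_upd exI exec.Const)

lemma runs_Arith:
  assumes "bounded B R M" "int i \<le> B" "int j \<le> B" "int k \<le> B"
    "\<bar>arith_val f (R j) (R k)\<bar> \<le> B"
  shows "runs B (Arith f i j k) (R, M) (Suc 0) (R(i := arith_val f (R j) (R k)), M)"
  unfolding runs_def
  using cell_cost_le[of i B "arith_val f (R j) (R k)"] cell_cost_le[of j B "R j"]
    cell_cost_le[of k B "R k"] assms boundedD(1)[OF assms(1)]
  by (auto intro!: bounded_upd exI exec.Arith)

lemma runs_Load:
  assumes "bounded B R M" "int i \<le> B" "int j \<le> B" "0 \<le> R j"
  shows "runs B (Load i j) (R, M) (Suc 0) (R(i := M (nat (R j))), M)"
proof -
  have *: "R j = int (nat (R j))" "int (nat (R j)) \<le> B"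
    using assms(4) boundedD(1)[OF assms(1), of j] by auto
  show ?thesis
    unfolding runs_def
    using cell_cost_le[of i B "M (nat (R j))"] cell_cost_le[of j B "R j"]
      cell_cost_le[of "nat (R j)" B "M (nat (R j))"] assms boundedD[OF assms(1)] *
    by (auto intro!: bounded_upd exI exec.Load)
qed

lemma runs_Store:
  assumes "bounded B R M" "int i \<le> B" "int j \<le> B" "0 \<le> R i"
  shows "runs B (Store i j) (R, M) (Suc 0) (R, M(nat (R i) := R j))"
proof -
  have *: "R i = int (nat (R i))" "int (nat (R i)) \<le> B"
    using assms(4) boundedD(1)[OF assms(1), of i] by auto
  show ?thesis
    unfolding runs_def
    using cell_cost_le[of i B "R i"] cell_cost_le[of j B "R j"]
      cell_cost_le[of "nat (R i)" B "R j"] assms boundedD[OF assms(1)] *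
    by (auto intro!: bounded_upd exI exec.Store)
qed

lemma runs_Skip: "bounded B R M \<Longrightarrow> runs B Skip (R, M) (Suc 0) (R, M)"
  unfolding runs_def by (auto intro!: exI exec.Skip simp: bits_def)

lemma runs_Seq:
  "runs B c s k s' \<Longrightarrow> runs B d s' l s'' \<Longrightarrow> runs B (Seq c d) s (k + l) s''"
  unfolding runs_def by (fastforce simp: add_mult_distrib intro: exec.Seq)

lemma runs_IfPos:
  assumes "bounded B R M" "int i \<le> B" "runs B (if R i > 0 then c else d) (R, M) k s'"
  shows "runs B (IfPos i c d) (R, M) (1 + k) s'"
proof -
  have "cell_cost i (R i) \<le> 6 * bits B"
    using cell_cost_le[of i B "R i"] assms boundedD(1)[OF assms(1), of i] by simp
  then show ?thesis
    using assms(3) unfolding runs_def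
    by (cases "R i > 0") (fastforce intro: exec.IfTrue exec.IfFalse)+
qed

lemma runs_WhileFalse:
  assumes "bounded B R M" "int i \<le> B" "R i \<le> 0"
  shows "runs B (WhilePos i c) (R, M) (Suc 0) (R, M)"
  unfolding runs_def
  using cell_cost_le[of i B "R i"] assms boundedD(1)[OF assms(1), of i]
  by (fastforce intro: exec.WhileFalse)

lemma runs_WhileTrue:
  assumes "bounded B R M" "int i \<le> B" "R i > 0"
    "runs B c (R, M) k s'" "runs B (WhilePos i c) s' l s''"
  shows "runs B (WhilePos i c) (R, M) (1 + k + l) s''"
proof -
  have "cell_cost i (R i) \<le> 6 * bits B"
    using cell_cost_le[of i B "R i"] assms boundedD(1)[OF assms(1), of i] by simp
  then show ?thesis
    using assms(3-5) unfolding runs_def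
    by (fastforce simp: add_mult_distrib intro: exec.WhileTrue)
qed

text \<open>Values are taken in an abstract store \<open>V\<close> that has to agree with the
  registers below \<open>scratch\<close> only. Thus the second operand can be evaluated after the
  first one has altered the scratch area.\<close>

lemma runs_eval_to:
  assumes "bounded B R M" "scratch \<le> d" "\<And>i. i < scratch \<Longrightarrow> R i = V i"
    "safe B e V M" "int d + int (height e) \<le> B"
  obtains R' where "runs B (eval_to e d) (R, M) (steps N (eval_to e d)) (R', M)"
    "R' d = exp_val e V M" "\<And>i. i < d \<Longrightarrow> R' i = R i"
  using assms
proof (induction e arbitrary: R d thesis)
  case (Num k)
  show ?case
    using Num.prems(1)[of "R(d := k)"] Num.prems(2-) runs_Const[of B R M d k]
    by (simp del: fun_upd_apply) simp
next
  case (Var i)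
  let ?R = "R(d := 0)"
  have "runs B (Const d 0) (R, M) (Suc 0) (?R, M)"
    by (rule runs_Const) (use Var.prems in auto)
  moreover have "runs B (Arith Add d i d) (?R, M) (Suc 0) (?R(d := arith_val Add (?R i) (?R d)), M)"
    by (rule runs_Arith) (use Var.prems boundedD(1)[OF Var.prems(2), of i] in \<open>auto intro!: bounded_upd\<close>)
  ultimately have "runs B (eval_to (Var i) d) (R, M) (steps N (eval_to (Var i) d))
      (?R(d := arith_val Add (?R i) (?R d)), M)"
    using runs_Seq by fastforce
  then show ?case
    by (rule Var.prems(1)) (use Var.prems in auto)
next
  case (Mem e)
  obtain R' where R': "runs B (eval_to e d) (R, M) (steps N (eval_to e d)) (R', M)"
    "R' d = exp_val e V M" "\<And>i. i < d \<Longrightarrow> R' i = R i"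
    by (rule Mem.IH[of d R]) (use Mem.prems in auto)
  have "runs B (Load d d) (R', M) (Suc 0) (R'(d := M (nat (R' d))), M)"
    by (rule runs_Load) (use R' runs_bounded[OF R'(1)] Mem.prems in auto)
  then have "runs B (eval_to (Mem e) d) (R, M) (steps N (eval_to (Mem e) d)) (R'(d := M (nat (R' d))), M)"
    using R'(1) runs_Seq by fastforce
  then show ?case
    by (rule Mem.prems(1)) (use R' in auto)
next
  case (Bin f e1 e2)
  obtain R1 where R1: "runs B (eval_to e1 d) (R, M) (steps N (eval_to e1 d)) (R1, M)"
    "R1 d = exp_val e1 V M" "\<And>i. i < d \<Longrightarrow> R1 i = R i"
    by (rule Bin.IH(1)[of d R]) (use Bin.prems in auto)
  obtain R2 where R2: "runs B (eval_to e2 (Suc d)) (R1, M) (steps N (eval_to e2 (Suc d))) (R2, M)"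
    "R2 (Suc d) = exp_val e2 V M" "\<And>i. i < Suc d \<Longrightarrow> R2 i = R1 i"
    by (rule Bin.IH(2)[of "Suc d" R1]) (use Bin.prems R1 runs_bounded[OF R1(1)] in auto)
  let ?R = "R2(d := arith_val f (R2 d) (R2 (Suc d)))"
  have "runs B (Arith f d d (Suc d)) (R2, M) (Suc 0) (?R, M)"
    by (rule runs_Arith) (use Bin.prems R1 R2 runs_bounded[OF R2(1)] in auto)
  then have "runs B (eval_to (Bin f e1 e2) d) (R, M) (steps N (eval_to (Bin f e1 e2) d)) (?R, M)"
    using runs_Seq[OF R1(1) runs_Seq[OF R2(1)]] by fastforce
  then show ?case
    by (rule Bin.prems(1)) (use R1 R2 in auto)
qed

section \<open>Weakest preconditions with step counts\<close>

text \<open>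
  Assertions only see the registers below \<^term>\<open>scratch\<close>; those from there on serve for the
  evaluation of expressions.
\<close>

definition wp :: "int \<Rightarrow> nat \<Rightarrow> com \<Rightarrow> (store \<Rightarrow> store \<Rightarrow> bool) \<Rightarrow> store \<Rightarrow> store \<Rightarrow> bool" where
  "wp B N c Q V M \<longleftrightarrow> (\<forall>R. bounded B R M \<longrightarrow> (\<forall>i<scratch. R i = V i) \<longrightarrow>
     (\<exists>R' V' M'. runs B c (R, M) (steps N c) (R', M') \<and> (\<forall>i<scratch. R' i = V' i) \<and> Q V' M'))"

lemma wpD:
  assumes "wp B N c Q V M" "bounded B R M" "\<And>i. i < scratch \<Longrightarrow> R i = V i"
  obtains R' V' M' where "runs B c (R, M) (steps N c) (R', M')"
    "\<And>i. i < scratch \<Longrightarrow> R' i = V' i" "Q V' M'"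
  using assms unfolding wp_def by metis

lemma wp_mono: "wp B N c P V M \<Longrightarrow> (\<And>V M. P V M \<Longrightarrow> Q V M) \<Longrightarrow> wp B N c Q V M"
  unfolding wp_def by blast

lemma wp_Skip: "Q V M \<Longrightarrow> wp B N Skip Q V M"
  unfolding wp_def steps.simps One_nat_def using runs_Skip by blast

lemma wp_Seq: "wp B N c (wp B N d Q) V M \<Longrightarrow> wp B N (Seq c d) Q V M"
  unfolding wp_def[of B N "Seq c d"]
proof (intro allI impI)
  fix R assume *: "wp B N c (wp B N d Q) V M" "bounded B R M" "\<forall>i<scratch. R i = V i"
  obtain R1 V1 M1 where 1: "runs B c (R, M) (steps N c) (R1, M1)"
    "\<And>i. i < scratch \<Longrightarrow> R1 i = V1 i" "wp B N d Q V1 M1"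
    by (rule wpD[OF *(1,2)]) (use *(3) in auto)
  obtain R2 V2 M2 where 2: "runs B d (R1, M1) (steps N d) (R2, M2)"
    "\<And>i. i < scratch \<Longrightarrow> R2 i = V2 i" "Q V2 M2"
    by (rule wpD[OF 1(3) runs_bounded[OF 1(1)]]) (use 1(2) in auto)
  show "\<exists>R' V' M'. runs B (Seq c d) (R, M) (steps N (Seq c d)) (R', M') \<and>
      (\<forall>i<scratch. R' i = V' i) \<and> Q V' M'"
    using runs_Seq[OF 1(1) 2(1)] 2(2,3) by auto
qed

text \<open>Evaluation starts at register 20 or 21 and reaches at most 20 registers higher, so all
  register indices stay below 50.\<close>

definition exp_ok :: "int \<Rightarrow> exp \<Rightarrow> store \<Rightarrow> store \<Rightarrow> bool" where
  "exp_ok B e V M \<longleftrightarrow> safe B e V M \<and> height e \<le> 20 \<and> 50 \<le> B"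

lemma wp_assign:
  assumes "exp_ok B e V M" "x < scratch" "Q (V(x := exp_val e V M)) M"
  shows "wp B N (assign x e) Q V M"
  unfolding wp_def
proof (intro allI impI)
  fix R assume R: "bounded B R M" "\<forall>i<scratch. R i = V i"
  obtain R1 where 1: "runs B (eval_to e scratch) (R, M) (steps N (eval_to e scratch)) (R1, M)"
    "R1 scratch = exp_val e V M" "\<And>i. i < scratch \<Longrightarrow> R1 i = R i"
    by (rule runs_eval_to[OF R(1), where d = scratch and V = V and e = e]) (use R assms in \<open>auto simp: exp_ok_def\<close>)
  let ?R2 = "R1(Suc scratch := 0)"
  have 2: "runs B (Const (Suc scratch) 0) (R1, M) (Suc 0) (?R2, M)"
    by (rule runs_Const) (use assms runs_bounded[OF 1(1)] in \<open>auto simp: exp_ok_def\<close>)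
  let ?R3 = "?R2(x := arith_val Add (?R2 scratch) (?R2 (Suc scratch)))"
  have 3: "runs B (Arith Add x scratch (Suc scratch)) (?R2, M) (Suc 0) (?R3, M)"
    by (rule runs_Arith)
      (use assms runs_bounded[OF 2] boundedD(1)[OF runs_bounded[OF 1(1)], of scratch]
       in \<open>auto simp: exp_ok_def\<close>)
  show "\<exists>R' V' M'. runs B (assign x e) (R, M) (steps N (assign x e)) (R', M') \<and>
      (\<forall>i<scratch. R' i = V' i) \<and> Q V' M'"
    using runs_Seq[OF 1(1) runs_Seq[OF 2 3]] assms 1 R
    by (intro exI[of _ ?R3] exI[of _ "V(x := exp_val e V M)"] exI[of _ M]) (auto simp: assign_def)
qed

lemma wp_mem_write:
  assumes "exp_ok B e1 V M" "exp_ok B e2 V M" "0 \<le> exp_val e1 V M"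
    "Q V (M(nat (exp_val e1 V M) := exp_val e2 V M))"
  shows "wp B N (mem_write e1 e2) Q V M"
  unfolding wp_def
proof (intro allI impI)
  fix R assume R: "bounded B R M" "\<forall>i<scratch. R i = V i"
  obtain R1 where 1: "runs B (eval_to e1 scratch) (R, M) (steps N (eval_to e1 scratch)) (R1, M)"
    "R1 scratch = exp_val e1 V M" "\<And>i. i < scratch \<Longrightarrow> R1 i = R i"
    by (rule runs_eval_to[OF R(1), where d = scratch and V = V and e = e1]) (use R assms in \<open>auto simp: exp_ok_def\<close>)
  obtain R2 where 2: "runs B (eval_to e2 (Suc scratch)) (R1, M) (steps N (eval_to e2 (Suc scratch))) (R2, M)"
    "R2 (Suc scratch) = exp_val e2 V M" "\<And>i. i < Suc scratch \<Longrightarrow> R2 i = R1 i"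
    by (rule runs_eval_to[OF runs_bounded[OF 1(1)], where d = "Suc scratch" and V = V and e = e2])
      (use R 1 assms in \<open>auto simp: exp_ok_def\<close>)
  let ?M = "M(nat (R2 scratch) := R2 (Suc scratch))"
  have 3: "runs B (Store scratch (Suc scratch)) (R2, M) (Suc 0) (R2, ?M)"
    by (rule runs_Store) (use assms 1 2 runs_bounded[OF 2(1)] in \<open>auto simp: exp_ok_def\<close>)
  show "\<exists>R' V' M'. runs B (mem_write e1 e2) (R, M) (steps N (mem_write e1 e2)) (R', M') \<and>
      (\<forall>i<scratch. R' i = V' i) \<and> Q V' M'"
    using runs_Seq[OF 1(1) runs_Seq[OF 2(1) 3]] assms 1 2 R
    by (intro exI[of _ R2] exI[of _ V] exI[of _ ?M]) (auto simp: mem_write_def)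
qed

lemma wp_if_pos:
  assumes "exp_ok B e V M" "exp_val e V M > 0 \<Longrightarrow> wp B N c Q V M"
    "exp_val e V M \<le> 0 \<Longrightarrow> wp B N d Q V M"
  shows "wp B N (if_pos e c d) Q V M"
  unfolding wp_def
proof (intro allI impI)
  fix R assume R: "bounded B R M" "\<forall>i<scratch. R i = V i"
  obtain R1 where 1: "runs B (eval_to e scratch) (R, M) (steps N (eval_to e scratch)) (R1, M)"
    "R1 scratch = exp_val e V M" "\<And>i. i < scratch \<Longrightarrow> R1 i = R i"
    by (rule runs_eval_to[OF R(1), where d = scratch and V = V and e = e]) (use R assms in \<open>auto simp: exp_ok_def\<close>)
  let ?c = "if exp_val e V M > 0 then c else d"
  obtain R2 V2 M2 where 2: "runs B ?c (R1, M) (steps N ?c) (R2, M2)"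
    "\<And>i. i < scratch \<Longrightarrow> R2 i = V2 i" "Q V2 M2"
    by (rule wpD[of B N ?c Q V M R1]) (use assms 1 R runs_bounded[OF 1(1)] in auto)
  have "runs B ?c (R1, M) (steps N c + steps N d) (R2, M2)"
    by (rule runs_mono[OF 2(1)]) simp
  then have "runs B (IfPos scratch c d) (R1, M) (1 + (steps N c + steps N d)) (R2, M2)"
    using runs_IfPos[OF runs_bounded[OF 1(1)], of scratch c d "steps N c + steps N d"]
      assms(1) 1(2) by (simp add: exp_ok_def)
  then show "\<exists>R' V' M'. runs B (if_pos e c d) (R, M) (steps N (if_pos e c d)) (R', M') \<and>
      (\<forall>i<scratch. R' i = V' i) \<and> Q V' M'"
    using runs_Seq[OF 1(1), of "IfPos scratch c d" "1 + (steps N c + steps N d)" "(R2, M2)"] 2(2,3)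
    by (intro exI[of _ R2] exI[of _ V2] exI[of _ M2]) (simp add: if_pos_def add.assoc)
qed

lemma wp_if_eq:
  assumes "exp_ok B (Bin Sub e1 e2) V M" "exp_ok B (Bin Sub e2 e1) V M"
    "exp_val e1 V M = exp_val e2 V M \<Longrightarrow> wp B N c Q V M"
    "exp_val e1 V M \<noteq> exp_val e2 V M \<Longrightarrow> wp B N d Q V M"
  shows "wp B N (if_eq e1 e2 c d) Q V M"
  unfolding if_eq_def by (intro wp_if_pos) (use assms in auto)

text \<open>The postcondition of the body already speaks about the incremented counter, so a use of
  the rule verifies the body alone. The body must leave both the counter and the limit as it found
  them.\<close>

lemma wp_for_upto:
  assumes Inv0: "Inv 0 (V(x := 0)) M"
    and bounds: "0 \<le> V y" "V y \<le> int N" "int N < B" "50 \<le> B"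
    and vars: "x < scratch" "y < scratch" "x \<noteq> y"
    and step: "\<And>j V' M'. j < nat (V y) \<Longrightarrow> Inv j V' M' \<Longrightarrow> V' x = int j \<Longrightarrow> V' y = V y \<Longrightarrow>
      wp B N c (\<lambda>V'' M''. Inv (Suc j) (V''(x := int (Suc j))) M'' \<and> V'' x = int j \<and> V'' y = V y) V' M'"
    and fin: "\<And>V' M'. Inv (nat (V y)) V' M' \<Longrightarrow> V' x = V y \<Longrightarrow> V' y = V y \<Longrightarrow> Q V' M'"
  shows "wp B N (for_upto x y c) Q V M"
proof -
  define d where "d = eval_to (Bin Sub (Var y) (Var x)) scratch"
  define inc where "inc = assign x (Bin Add (Var x) (Num 1))"
  let ?body = "Seq (Seq c inc) d"
  let ?b = "1 + steps N ?body"
  define J where "J j V' M' \<longleftrightarrow> Inv j V' M' \<and> V' x = int j \<and> V' y = V y" for j V' M'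
  \<comment> \<open>Serves for the test before the first round and for the one at the end of each
    round.\<close>
  have test: "\<exists>R'. runs B (Seq e d) (R, M0) (steps N (Seq e d)) (R', M') \<and>
      R' scratch = V y - int j \<and> (\<forall>i<scratch. R' i = V' i)"
    if e: "runs B e (R, M0) (steps N e) (R1, M')" "\<And>i. i < scratch \<Longrightarrow> R1 i = V' i" "J j V' M'"
      and j: "int j \<le> V y" for e R M0 R1 V' M' j
  proof -
    have "safe B (Bin Sub (Var y) (Var x)) V' M'"
      using bounds vars e(3) j by (auto simp: J_def)
    moreover have "int scratch + int (height (Bin Sub (Var y) (Var x))) \<le> B"
      using bounds by simp
    ultimately obtain R2 where "runs B d (R1, M') (steps N d) (R2, M')"
      "R2 scratch = exp_val (Bin Sub (Var y) (Var x)) V' M'" "\<And>i. i < scratch \<Longrightarrow> R2 i = R1 i"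
      using runs_eval_to[OF runs_bounded[OF e(1)], of scratch V' "Bin Sub (Var y) (Var x)" N] e(2) bounds
      unfolding d_def by (metis le_refl)
    then show ?thesis
      using runs_Seq[OF e(1), of d "steps N d" "(R2, M')"] e(2,3) by (intro exI[of _ R2]) (auto simp: J_def)
  qed
  \<comment> \<open>Induction on the number \<open>r\<close> of remaining rounds, which is the
    content of the test register.\<close>
  have loop: "\<exists>R'' V'' M''. runs B (WhilePos scratch ?body) (R, M') (1 + r * ?b) (R'', M'') \<and>
      (\<forall>i<scratch. R'' i = V'' i) \<and> Q V'' M''"
    if "int r + int j = V y" "J j V' M'" "bounded B R M'"
      "\<forall>i<scratch. R i = V' i" "R scratch = int r" for r j V' M' R
    using that
  proof (induction r arbitrary: j V' M' R)
    case 0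
    then have "runs B (WhilePos scratch ?body) (R, M') (Suc 0) (R, M')"
      using bounds by (intro runs_WhileFalse) auto
    moreover have "Q V' M'"
      using 0 fin[of V' M'] by (metis J_def add_0 nat_int of_nat_0)
    ultimately show ?case using "0.prems" by auto
  next
    case (Suc r)
    have j: "j < nat (V y)" "int j + 1 \<le> V y" using Suc.prems(1) by auto
    have "wp B N (Seq c inc) (J (Suc j)) V' M'"
    proof (rule wp_Seq, rule wp_mono, rule step[OF j(1)])
      fix V'' M''
      assume "Inv (Suc j) (V''(x := int (Suc j))) M'' \<and> V'' x = int j \<and> V'' y = V y"
      then show "wp B N inc (J (Suc j)) V'' M''"
        using vars bounds j unfolding inc_def by (intro wp_assign) (auto simp: J_def exp_ok_def add.commute)
    qed (use Suc.prems in \<open>auto simp: J_def\<close>)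
    then obtain R1 V1 M1 where 1: "runs B (Seq c inc) (R, M') (steps N (Seq c inc)) (R1, M1)"
      "\<And>i. i < scratch \<Longrightarrow> R1 i = V1 i" "J (Suc j) V1 M1"
      by (rule wpD[where R = R]) (use Suc.prems in auto)
    obtain R2 where 2: "runs B ?body (R, M') (steps N ?body) (R2, M1)"
      "R2 scratch = V y - int (Suc j)" "\<forall>i<scratch. R2 i = V1 i"
      using test[OF 1] j by auto
    obtain R3 V3 M3 where 3: "runs B (WhilePos scratch ?body) (R2, M1) (1 + r * ?b) (R3, M3)"
      "\<forall>i<scratch. R3 i = V3 i" "Q V3 M3"
      using Suc.IH[of "Suc j" V1 M1 R2] 1(3) 2 Suc.prems(1) runs_bounded[OF 2(1)] by auto
    have "runs B (WhilePos scratch ?body) (R, M') (1 + steps N ?body + (1 + r * ?b)) (R3, M3)"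
      by (rule runs_WhileTrue[OF _ _ _ 2(1) 3(1)]) (use Suc.prems bounds in auto)
    then show ?case using 3(2,3) by (auto simp: algebra_simps)
  qed
  show ?thesis
    unfolding wp_def
  proof (intro allI impI)
    fix R assume R: "bounded B R M" "\<forall>i<scratch. R i = V i"
    have "wp B N (assign x (Num 0)) (J 0) V M"
      using vars bounds Inv0 by (intro wp_assign) (auto simp: J_def exp_ok_def)
    then obtain R1 V1 M1 where 1: "runs B (assign x (Num 0)) (R, M) (steps N (assign x (Num 0))) (R1, M1)"
      "\<And>i. i < scratch \<Longrightarrow> R1 i = V1 i" "J 0 V1 M1"
      by (rule wpD[where R = R]) (use R in auto)
    obtain R2 where 2: "runs B (Seq (assign x (Num 0)) d) (R, M) (steps N (Seq (assign x (Num 0)) d)) (R2, M1)"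
      "R2 scratch = V y" "\<forall>i<scratch. R2 i = V1 i"
      using test[OF 1] bounds by auto
    obtain R3 V3 M3 where 3: "runs B (WhilePos scratch ?body) (R2, M1) (1 + nat (V y) * ?b) (R3, M3)"
      "\<forall>i<scratch. R3 i = V3 i" "Q V3 M3"
      using loop[of "nat (V y)" 0 V1 M1 R2] 1(3) 2 runs_bounded[OF 2(1)] bounds by auto
    have "1 + nat (V y) * ?b \<le> 1 + N * ?b"
      using bounds by (intro add_left_mono mult_le_mono1) auto
    from runs_Seq[OF 2(1) runs_mono[OF 3(1) this]] 3(2,3)
    show "\<exists>R' V' M'. runs B (for_upto x y c) (R, M) (steps N (for_upto x y c)) (R', M') \<and>
        (\<forall>i<scratch. R' i = V' i) \<and> Q V' M'"
      by (auto simp del: eval_to.simps simp: for_upto_def Let_def d_def inc_def)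
  qed
qed


section \<open>Best schemes on a laminar family\<close>

text \<open>The contribution of the states in \<open>P\<close> to the scaled utility, without its
  constant, when exactly the signals with \<open>rep \<sigma> \<in> X\<close> are accepted: a 0/1
  scheme has maximum 1 on \<open>N \<theta>\<close> if and only if it accepts a signal
  there.\<close>

definition hits :: "(nat \<Rightarrow> nat set) \<Rightarrow> (nat \<Rightarrow> int) \<Rightarrow> nat set \<Rightarrow> (nat \<Rightarrow> nat) \<Rightarrow> nat set \<Rightarrow> int" where
  "hits N w P rep X = (\<Sum>\<theta>\<in>P. if \<exists>\<sigma>\<in>N \<theta>. rep \<sigma> \<in> X then w \<theta> else 0)"

text \<open>
  State of the algorithm after the states in \<open>P\<close>: \<open>c\<close> maps a signal to the leader of its component
  and is needed in the proof only. The best set of the component of a leader \<open>l\<close> consists of the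
  signals with \<open>rep \<sigma> = l\<close> and has value \<open>val l\<close>; signals which will not be accepted any more have
  \<open>rep \<sigma> = m\<close>, which is not a signal.
\<close>

definition best_schemes ::
  "nat \<Rightarrow> nat \<Rightarrow> (nat \<Rightarrow> nat set) \<Rightarrow> (nat \<Rightarrow> int) \<Rightarrow> nat set \<Rightarrow> (nat \<Rightarrow> nat) \<Rightarrow> (nat \<Rightarrow> nat) \<Rightarrow> (nat \<Rightarrow> int) \<Rightarrow> bool" where
  "best_schemes n m N w P c rep val \<longleftrightarrow>
     (\<forall>\<sigma><m. c \<sigma> < m \<and> c (c \<sigma>) = c \<sigma> \<and> rep (c \<sigma>) = c \<sigma> \<and> (rep \<sigma> = c \<sigma> \<or> rep \<sigma> = m)) \<and>
     (\<forall>\<theta><n. \<theta> \<notin> P \<longrightarrow> (\<forall>\<sigma>\<in>N \<theta>. \<forall>\<tau><m. c \<tau> = c \<sigma> \<longrightarrow> \<tau> \<in> N \<theta>)) \<and>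
     (\<forall>\<psi> :: nat \<Rightarrow> real. (\<forall>\<sigma><m. 0 \<le> \<psi> \<sigma>) \<longrightarrow>
       (\<Sum>\<theta>\<in>P. w \<theta> * Max (\<psi> ` N \<theta>)) \<le>
       (\<Sum>l\<in>c ` {..<m}. val l * Max (\<psi> ` {\<sigma>\<in>{..<m}. c \<sigma> = l}))) \<and>
     (\<forall>X \<subseteq> c ` {..<m}. hits N w P rep X = sum val X)"

lemma best_schemesD:
  assumes "best_schemes n m N w P c rep val"
  shows "\<sigma> < m \<Longrightarrow> c \<sigma> < m" "\<sigma> < m \<Longrightarrow> c (c \<sigma>) = c \<sigma>" "\<sigma> < m \<Longrightarrow> rep (c \<sigma>) = c \<sigma>"
    "\<sigma> < m \<Longrightarrow> rep \<sigma> = c \<sigma> \<or> rep \<sigma> = m"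
    "\<theta> < n \<Longrightarrow> \<theta> \<notin> P \<Longrightarrow> \<sigma> \<in> N \<theta> \<Longrightarrow> \<tau> < m \<Longrightarrow> c \<tau> = c \<sigma> \<Longrightarrow> \<tau> \<in> N \<theta>"
    "(\<And>\<sigma>. \<sigma> < m \<Longrightarrow> 0 \<le> (\<psi> \<sigma> :: real)) \<Longrightarrow> (\<Sum>\<theta>\<in>P. w \<theta> * Max (\<psi> ` N \<theta>)) \<le>
       (\<Sum>l\<in>c ` {..<m}. val l * Max (\<psi> ` {\<sigma>\<in>{..<m}. c \<sigma> = l}))"
    "X \<subseteq> c ` {..<m} \<Longrightarrow> hits N w P rep X = sum val X"
  using assms unfolding best_schemes_def by blast+

text \<open>This lets the program do without the map \<open>c\<close>: leaders are visible as fixed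
  points of \<open>rep\<close>.\<close>

lemma best_schemes_leader_iff:
  assumes "best_schemes n m N w P c rep val" "l < m"
  shows "l \<in> c ` {..<m} \<longleftrightarrow> rep l = l"
proof
  assume "l \<in> c ` {..<m}"
  then show "rep l = l" using best_schemesD(3)[OF assms(1)] by auto
next
  assume "rep l = l"
  then have "c l = l" using best_schemesD(4)[OF assms(1,2)] assms(2) by auto
  then show "l \<in> c ` {..<m}" using assms(2) by (metis imageI lessThan_iff)
qed

lemma best_schemes_init:
  assumes "\<And>\<theta>. \<theta> < n \<Longrightarrow> N \<theta> \<subseteq> {..<m}"
  shows "best_schemes n m N w {} (\<lambda>\<sigma>. \<sigma>) (\<lambda>\<sigma>. \<sigma>) (\<lambda>\<sigma>. 0)"
  using assms by (auto simp: best_schemes_def hits_def)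

lemma best_schemes_cong:
  assumes "best_schemes n m N w P c rep val"
    "\<And>\<sigma>. \<sigma> < m \<Longrightarrow> rep' \<sigma> = rep \<sigma>" "\<And>\<sigma>. \<sigma> < m \<Longrightarrow> val' \<sigma> = val \<sigma>"
    "P \<subseteq> {..<n}" "\<And>\<theta>. \<theta> < n \<Longrightarrow> N \<theta> \<subseteq> {..<m}"
  shows "best_schemes n m N w P c rep' val'"
proof -
  note D = best_schemesD[OF assms(1)]
  have "hits N w P rep' X = hits N w P rep X" for X
    unfolding hits_def
  proof (rule sum.cong[OF refl])
    fix \<theta> assume "\<theta> \<in> P"
    then have "N \<theta> \<subseteq> {..<m}" using assms(4,5) by auto
    then have "(\<exists>\<sigma>\<in>N \<theta>. rep' \<sigma> \<in> X) \<longleftrightarrow> (\<exists>\<sigma>\<in>N \<theta>. rep \<sigma> \<in> X)" using assms(2) by (intro bex_cong) auto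
    then show "(if \<exists>\<sigma>\<in>N \<theta>. rep' \<sigma> \<in> X then w \<theta> else 0) = (if \<exists>\<sigma>\<in>N \<theta>. rep \<sigma> \<in> X then w \<theta> else 0)"
      by simp
  qed
  moreover have "sum val' X = sum val X" if "X \<subseteq> c ` {..<m}" for X
    by (rule sum.cong) (use that assms(3) D(1) in auto)
  moreover have "(\<Sum>l\<in>c ` {..<m}. val' l * Max (\<psi> ` {\<sigma>\<in>{..<m}. c \<sigma> = l})) =
      (\<Sum>l\<in>c ` {..<m}. val l * Max (\<psi> ` {\<sigma>\<in>{..<m}. c \<sigma> = l}))" for \<psi> :: "nat \<Rightarrow> real"
    by (rule sum.cong) (use assms(3) D(1) in auto)
  ultimately show ?thesis
    using D assms(2) unfolding best_schemes_def by simp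
qed

lemma abs_hits_le: "\<bar>hits N w P rep X\<bar> \<le> (\<Sum>\<theta>\<in>P. \<bar>w \<theta>\<bar>)"
  unfolding hits_def by (intro order.trans[OF sum_abs] sum_mono) auto

text \<open>A sum of stored values is the net weight of the states hit, so it never exceeds the
  total absolute weight. Singletons bound the stored values, larger sets the running sum of the
  search.\<close>

lemma best_schemes_bound:
  assumes "best_schemes n m N w P c rep val" "P \<subseteq> {..<n}" "X \<subseteq> {l\<in>{..<m}. rep l = l}"
  shows "\<bar>sum val X\<bar> \<le> (\<Sum>\<theta><n. \<bar>w \<theta>\<bar>)"
proof -
  have "X \<subseteq> c ` {..<m}" using assms(3) best_schemes_leader_iff[OF assms(1)] by blast
  then have "\<bar>sum val X\<bar> \<le> (\<Sum>\<theta>\<in>P. \<bar>w \<theta>\<bar>)"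
    using best_schemesD(7)[OF assms(1), of X] abs_hits_le[of N w P rep X] by simp
  also have "\<dots> \<le> (\<Sum>\<theta><n. \<bar>w \<theta>\<bar>)"
    by (rule sum_mono2) (use assms(2) in auto)
  finally show ?thesis .
qed

section \<open>Merging the components inside a neighbourhood\<close>

text \<open>
  \<open>L\<close> stands for the components absorbed by a neighbourhood, \<open>M\<close> for the maxima of a scheme on them.
\<close>

lemma weighted_max_le:
  fixes M :: "'a \<Rightarrow> real" and v :: "'a \<Rightarrow> int"
  assumes "finite L" "b \<in> L" "\<And>l. l \<in> L \<Longrightarrow> v l \<le> v b"
    "\<And>l. l \<in> L \<Longrightarrow> 0 \<le> M l \<and> M l \<le> x" "\<exists>l\<in>L. M l = x"
    and s: "s = sum v {l\<in>L. v l > 0}"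
  shows "(\<Sum>l\<in>L. v l * M l) \<le> of_int (if s > 0 then s else v b) * x"
proof (cases "s > 0")
  case True
  \<comment> \<open>The sum only grows when nonpositive terms are dropped and \<open>M l\<close> is
    raised to \<open>x\<close> in the positive ones.\<close>
  have "(\<Sum>l\<in>L. v l * M l) \<le> (\<Sum>l\<in>L. if v l > 0 then v l * x else 0)"
    using assms(4) by (intro sum_mono) (auto intro: mult_left_mono mult_nonpos_nonneg)
  also have "\<dots> = (\<Sum>l\<in>{l\<in>L. v l > 0}. v l * x)"
    by (rule sum.mono_neutral_cong_right) (use assms in auto)
  also have "\<dots> = of_int s * x"
    by (simp add: s sum_distrib_right)
  finally show ?thesis using True by simp
next
  case False
  have nonpos: "v l \<le> 0" if "l \<in> L" for l
  proof (rule ccontr)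
    assume "\<not> v l \<le> 0"
    then have "0 < sum v {l\<in>L. v l > 0}"
      using that assms(1) by (intro sum_pos) auto
    then show False using False s by simp
  qed
  \<comment> \<open>All values are nonpositive here, so every term may be dropped except that of a
    component attaining the maximum \<open>x\<close>.\<close>
  obtain l where l: "l \<in> L" "M l = x" using assms(5) by blast
  have "(\<Sum>l\<in>L. v l * M l) = v l * x + (\<Sum>l\<in>L - {l}. v l * M l)"
    using l assms(1) by (simp add: sum.remove)
  also have "\<dots> \<le> v l * x"
    using nonpos assms(4) by (simp, intro sum_nonpos mult_nonpos_nonneg) auto
  also have "\<dots> \<le> v b * x"
    using assms(3,4) l by (intro mult_right_mono) auto
  finally show ?thesis using False by simp
qed

text \<open>The components inside \<open>N \<theta>\<close> merge into one with leader
  \<open>b\<close>. The signals kept are those of the components of positive value and always those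
  of \<open>b\<close>; if any value is positive, so is the largest one, hence this single rule
  covers both cases of the choice. As the kept set is nonempty and lies in
  \<open>N \<theta>\<close>, the weight of \<theta> is incurred in full.\<close>

lemma best_schemes_step:
  assumes inv: "best_schemes n m N w P c rep val"
    and N: "\<And>\<theta>. \<theta> < n \<Longrightarrow> N \<theta> \<subseteq> {..<m}" and lam: "laminar (N ` {..<n})"
    and P: "P \<subseteq> {..<n}" and \<theta>: "\<theta> < n" "\<theta> \<notin> P"
    and minimal: "\<And>\<eta>. \<eta> < n \<Longrightarrow> \<eta> \<notin> P \<Longrightarrow> card (N \<theta>) \<le> card (N \<eta>)"
    and b: "b \<in> N \<theta>" "rep b = b" "\<And>l. l \<in> N \<theta> \<Longrightarrow> rep l = l \<Longrightarrow> val l \<le> val b"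
    and s: "s = sum val {l\<in>N \<theta>. rep l = l \<and> val l > 0}"
  defines "rep' \<equiv> \<lambda>\<sigma>. if \<sigma> \<in> N \<theta> then if rep \<sigma> = b \<or> rep \<sigma> < m \<and> val (rep \<sigma>) > 0 then b else m else rep \<sigma>"
    and "val' \<equiv> val(b := (if s > 0 then s else val b) + w \<theta>)"
    and "c' \<equiv> \<lambda>\<sigma>. if \<sigma> \<in> N \<theta> then b else c \<sigma>"
  shows "best_schemes n m N w (insert \<theta> P) c' rep' val'"
proof -
  note D = best_schemesD[OF inv]
  define A where "A = N \<theta>"
  define LA where "LA = c ` A"
  define LO where "LO = c ` ({..<m} - A)"
  have A: "A \<subseteq> {..<m}" "finite A" using N[OF \<theta>(1)] finite_subset unfolding A_def by auto
  \<comment> \<open>As \<theta> is still unprocessed, \<open>A\<close> is itself a union of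
    components.\<close>
  have sat: "\<tau> \<in> A" if "\<sigma> \<in> A" "\<tau> < m" "c \<tau> = c \<sigma>" for \<sigma> \<tau>
    using D(5)[OF \<theta>, of \<sigma> \<tau>] that unfolding A_def by auto
  have cA: "c \<sigma> \<in> A" if "\<sigma> \<in> A" for \<sigma>
    using sat[OF that] D(1,2) that A by auto
  have cO: "c \<sigma> \<notin> A" if "\<sigma> < m" "\<sigma> \<notin> A" for \<sigma>
    using sat[of "c \<sigma>" \<sigma>] D(2) that by auto
  have LA_iff: "l \<in> LA \<longleftrightarrow> l \<in> A \<and> rep l = l" for l
  proof
    assume "l \<in> LA"
    then show "l \<in> A \<and> rep l = l" unfolding LA_def using cA D(3) A by auto
  next
    assume *: "l \<in> A \<and> rep l = l"
    then have "l < m" using A by auto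
    then have "c l = l" using D(4)[of l] * by auto
    then show "l \<in> LA" unfolding LA_def using * by (metis imageI)
  qed
  have L: "c ` {..<m} = LA \<union> LO" using A unfolding LA_def LO_def by blast
  have LO_A: "LO \<inter> A = {}" unfolding LO_def using cO by auto
  have disj: "LA \<inter> LO = {}" using LO_A LA_iff by auto
  have fin: "finite LA" "finite LO" using A unfolding LA_def LO_def by auto
  have bA: "b \<in> A" "b < m" "b \<in> LA" "b \<notin> LO" using b LA_iff LO_A A unfolding A_def by auto
  have cb: "c b = b" using D(4)[of b] bA b by auto
  have L': "c' ` {..<m} = insert b LO" using A bA unfolding c'_def LO_def A_def by auto
  have s': "s = sum val {l\<in>LA. val l > 0}"
    unfolding s LA_iff A_def by (rule arg_cong[where f = "sum val"]) auto
  have 1: "c' \<sigma> < m \<and> c' (c' \<sigma>) = c' \<sigma> \<and> rep' (c' \<sigma>) = c' \<sigma> \<and> (rep' \<sigma> = c' \<sigma> \<or> rep' \<sigma> = m)" if "\<sigma> < m" for \<sigma>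
    using that D(1-4)[of \<sigma>] cO[of \<sigma>] bA b cb unfolding c'_def rep'_def A_def by auto
  have 2: "\<tau> \<in> N \<eta>" if "\<eta> < n" "\<eta> \<notin> insert \<theta> P" "\<sigma> \<in> N \<eta>" "\<tau> < m" "c' \<tau> = c' \<sigma>" for \<eta> \<sigma> \<tau>
  proof -
    have fN: "finite (N \<eta>)" "\<sigma> < m" using N[OF that(1)] that(3) finite_subset by auto
    have "A \<inter> N \<eta> = {} \<or> A \<subseteq> N \<eta> \<or> N \<eta> \<subseteq> A"
      using lam \<theta>(1) that(1) unfolding laminar_def A_def by blast
    \<comment> \<open>A neighbourhood contained in \<open>A\<close> equals \<open>A\<close>, because
      none of the unprocessed ones is smaller. So later neighbourhoods never split the new
      component.\<close>
    then have "A \<inter> N \<eta> = {} \<or> A \<subseteq> N \<eta>"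
      using minimal[of \<eta>] that A card_seteq[of A "N \<eta>"] unfolding A_def by auto
    then show ?thesis
    proof
      assume "A \<inter> N \<eta> = {}"
      then have \<sigma>: "\<sigma> \<notin> A" using that by auto
      then have "c \<sigma> \<notin> A" using cO fN by auto
      then have "\<tau> \<notin> A" using that(5) bA \<sigma> unfolding c'_def A_def by (auto split: if_splits)
      then have "c \<tau> = c \<sigma>" using that(5) \<sigma> unfolding c'_def A_def by auto
      then show ?thesis using D(5)[OF that(1) _ that(3,4)] that(2) by auto
    next
      assume *: "A \<subseteq> N \<eta>"
      show ?thesis
      proof (cases "\<tau> \<in> A")
        case True then show ?thesis using * by auto
      next
        case False
        then have "c \<tau> \<notin> A" using cO that by auto
        then have "\<sigma> \<notin> A" using that(5) bA False unfolding c'_def A_def by (auto split: if_splits)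
        then have "c \<tau> = c \<sigma>" using that(5) False unfolding c'_def A_def by auto
        then show ?thesis using D(5)[OF that(1) _ that(3,4)] that(2) by auto
      qed
    qed
  qed
  have finP: "finite P" using P finite_subset by auto
  have 3: "(\<Sum>\<theta>\<in>insert \<theta> P. w \<theta> * Max (\<psi> ` N \<theta>)) \<le>
       (\<Sum>l\<in>c' ` {..<m}. val' l * Max (\<psi> ` {\<sigma>\<in>{..<m}. c' \<sigma> = l}))"
    if \<psi>: "\<forall>\<sigma><m. 0 \<le> \<psi> \<sigma>" for \<psi> :: "nat \<Rightarrow> real"
  proof -
    define M where "M l = Max (\<psi> ` {\<sigma>\<in>{..<m}. c \<sigma> = l})" for l
    define x where "x = Max (\<psi> ` A)"
    have M_ge: "\<psi> \<sigma> \<le> M (c \<sigma>)" if "\<sigma> < m" for \<sigma>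
      unfolding M_def by (rule Max_ge) (use that in auto)
    have M_le: "M l \<le> x" if l: "l \<in> LA" for l
    proof -
      obtain \<sigma> where \<sigma>: "\<sigma> \<in> A" "l = c \<sigma>" using l unfolding LA_def by blast
      show ?thesis unfolding M_def x_def
        by (rule Max_mono) (use \<sigma> A sat in auto)
    qed
    have M_nonneg: "0 \<le> M l" if l: "l \<in> LA" for l
    proof -
      obtain \<sigma> where \<sigma>: "\<sigma> \<in> A" "l = c \<sigma>" using l unfolding LA_def by blast
      then have "\<sigma> < m" using A by auto
      then show ?thesis using M_ge[of \<sigma>] \<psi> \<sigma> by force
    qed
    have "x \<in> \<psi> ` A" unfolding x_def by (rule Max_in) (use A bA in auto)
    then obtain \<sigma> where \<sigma>: "\<sigma> \<in> A" "x = \<psi> \<sigma>" by auto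
    then have "M (c \<sigma>) = x"
      using M_ge[of \<sigma>] M_le[of "c \<sigma>"] A unfolding LA_def by fastforce
    then have ex: "\<exists>l\<in>LA. M l = x" using \<sigma> unfolding LA_def by auto
    \<comment> \<open>The absorption inequality for the old components inside \<open>A\<close>.
      Since \<open>x\<close> is also the maximum of \<psi> on \<open>N \<theta>\<close>, the new
      state just adds its weight to the coefficient of \<open>x\<close>.\<close>
    have key: "(\<Sum>l\<in>LA. val l * M l) \<le> of_int (if s > 0 then s else val b) * x"
      by (rule weighted_max_le[OF fin(1) bA(3) _ _ ex s'])
        (use M_le M_nonneg b(3) LA_iff in \<open>auto simp: A_def\<close>)
    have "(\<Sum>\<theta>\<in>insert \<theta> P. w \<theta> * Max (\<psi> ` N \<theta>)) = w \<theta> * x + (\<Sum>\<theta>\<in>P. w \<theta> * Max (\<psi> ` N \<theta>))"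
      using finP \<theta> by (simp add: x_def A_def)
    also have "\<dots> \<le> w \<theta> * x + (\<Sum>l\<in>c ` {..<m}. val l * M l)"
      using D(6)[of \<psi>] \<psi> by (simp add: M_def)
    also have "\<dots> = w \<theta> * x + (\<Sum>l\<in>LA. val l * M l) + (\<Sum>l\<in>LO. val l * M l)"
      unfolding L using fin disj by (simp add: sum.union_disjoint)
    also have "\<dots> \<le> val' b * x + (\<Sum>l\<in>LO. val l * M l)"
      using key by (simp add: val'_def algebra_simps)
    also have "\<dots> = (\<Sum>l\<in>c' ` {..<m}. val' l * Max (\<psi> ` {\<sigma>\<in>{..<m}. c' \<sigma> = l}))"
    proof -
      have "{\<sigma>\<in>{..<m}. c' \<sigma> = b} = A"
        using A bA cO unfolding c'_def A_def by (auto split: if_splits)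
      moreover have "{\<sigma>\<in>{..<m}. c' \<sigma> = l} = {\<sigma>\<in>{..<m}. c \<sigma> = l}" if "l \<in> LO" for l
        using that LO_A bA cA unfolding c'_def A_def by (auto split: if_splits)
      ultimately show ?thesis
        unfolding L' using fin bA by (auto simp: x_def M_def val'_def intro!: sum.cong)
    qed
    finally show ?thesis .
  qed
  have 4: "hits N w (insert \<theta> P) rep' X = sum val' X" if "X \<subseteq> c' ` {..<m}" for X
  proof -
    \<comment> \<open>\<open>Y\<close> is the old collection of leaders that accepts the same
      signals as \<open>X\<close> does after relabelling: \<open>b\<close> unfolds into the
      components in \<open>LP\<close> that it has taken over.\<close>
    define LP where "LP = {l\<in>LA. l = b \<or> val l > 0}"
    define Y where "Y = (X - {b}) \<union> (if b \<in> X then LP else {})"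
    have X: "X - {b} \<subseteq> LO" using that L' by auto
    have Xm: "m \<notin> X" using that 1 by force
    have YL: "Y \<subseteq> c ` {..<m}" using X unfolding L Y_def LP_def by auto
    have rep_iff: "rep' \<sigma> \<in> X \<longleftrightarrow> rep \<sigma> \<in> Y" if "\<sigma> < m" for \<sigma>
    proof (cases "\<sigma> \<in> A")
      case True
      have "rep \<sigma> \<in> LA \<or> rep \<sigma> = m" using D(4)[OF that] True unfolding LA_def by auto
      moreover have "m \<notin> LA" using LA_iff A by auto
      moreover have "LA \<subseteq> {..<m}" using LA_iff A by auto
      ultimately show ?thesis
        using True X Xm bA disj unfolding rep'_def Y_def LP_def A_def by auto
    next
      case False
      have "rep \<sigma> \<in> LO \<or> rep \<sigma> = m" using D(4)[OF that] that False unfolding LO_def by auto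
      moreover have "m \<notin> Y" using YL D(1) by auto
      ultimately show ?thesis
        using False Xm bA disj unfolding rep'_def Y_def LP_def A_def by auto
    qed
    have "hits N w P rep' X = hits N w P rep Y"
      unfolding hits_def
    proof (rule sum.cong[OF refl])
      fix \<eta> assume "\<eta> \<in> P"
      then have "N \<eta> \<subseteq> {..<m}" using P N by auto
      then have "(\<exists>\<sigma>\<in>N \<eta>. rep' \<sigma> \<in> X) \<longleftrightarrow> (\<exists>\<sigma>\<in>N \<eta>. rep \<sigma> \<in> Y)" using rep_iff by (intro bex_cong) auto
      then show "(if \<exists>\<sigma>\<in>N \<eta>. rep' \<sigma> \<in> X then w \<eta> else 0) = (if \<exists>\<sigma>\<in>N \<eta>. rep \<sigma> \<in> Y then w \<eta> else 0)"
        by simp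
    qed
    also have "\<dots> = sum val Y" by (rule D(7)[OF YL])
    finally have "hits N w P rep' X = sum val Y" .
    \<comment> \<open>All signals of \<open>A\<close> now carry the label \<open>b\<close> or
      \<open>m\<close>, and \<open>b\<close> itself carries \<open>b\<close>.\<close>
    moreover have "(\<exists>\<sigma>\<in>A. rep' \<sigma> \<in> X) \<longleftrightarrow> b \<in> X"
      using Xm bA b unfolding rep'_def A_def by auto
    ultimately have hX: "hits N w (insert \<theta> P) rep' X = (if b \<in> X then w \<theta> else 0) + sum val Y"
      using finP \<theta> by (simp add: hits_def A_def)
    show ?thesis
    proof (cases "b \<in> X")
      case False
      then have "sum val' X = sum val X" by (intro sum.cong) (auto simp: val'_def)
      then show ?thesis using hX False by (simp add: Y_def)
    next
      case True
      have LPs: "sum val LP = (if s > 0 then s else val b)"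
      proof (cases "\<exists>l\<in>LA. val l > 0")
        case True
        then have "val b > 0" using b(3) LA_iff unfolding A_def by force
        then have "LP = {l\<in>LA. val l > 0}" unfolding LP_def by auto
        moreover have "sum val {l\<in>LA. val l > 0} > 0" using True fin by (intro sum_pos) auto
        ultimately show ?thesis using s' by simp
      next
        case False
        then have "LP = {b}" using bA unfolding LP_def by auto
        moreover have "{l\<in>LA. val l > 0} = {}" using False by auto
        then have "s = 0" using s' by (simp only: sum.empty)
        ultimately show ?thesis by simp
      qed
      have "finite (X - {b})" using X fin finite_subset by blast
      moreover have "finite LP" using fin unfolding LP_def by auto
      moreover have "(X - {b}) \<inter> LP = {}" using X disj unfolding LP_def by auto
      ultimately have "sum val Y = sum val (X - {b}) + sum val LP"
        unfolding Y_def using True by (simp add: sum.union_disjoint)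
      moreover have "sum val' X = val' b + sum val' (X - {b})"
        using True \<open>finite (X - {b})\<close> by (simp add: sum.remove)
      moreover have "sum val' (X - {b}) = sum val (X - {b})"
        by (rule sum.cong) (auto simp: val'_def)
      ultimately show ?thesis using hX True LPs by (simp add: val'_def)
    qed
  qed
  show ?thesis
    unfolding best_schemes_def using 1 2 3 4 by blast
qed

text \<open>The two halves of the invariant meet. With maxima in [0, 1] the upper bound is at most
  the sum of the positive values, and exactness for the set of leaders with positive value attains
  this sum. The hypothesis on \<open>val m\<close> makes the dummy label mean rejection.\<close>

lemma best_schemes_optimal:
  fixes \<psi> :: "nat \<Rightarrow> real"
  assumes inv: "best_schemes n m N w {..<n} c rep val" and "val m \<le> 0"
    and N: "\<And>\<theta>. \<theta> < n \<Longrightarrow> N \<theta> \<subseteq> {..<m}" "\<And>\<theta>. \<theta> < n \<Longrightarrow> N \<theta> \<noteq> {}"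
    and \<psi>: "\<And>\<sigma>. \<sigma> < m \<Longrightarrow> 0 \<le> \<psi> \<sigma> \<and> \<psi> \<sigma> \<le> 1"
  shows "(\<Sum>\<theta><n. w \<theta> * Max (\<psi> ` N \<theta>)) \<le>
    (\<Sum>\<theta><n. w \<theta> * (MAX \<sigma>\<in>N \<theta>. of_bool (val (rep \<sigma>) > 0) :: real))"
proof -
  note D = best_schemesD[OF inv]
  define X where "X = {l\<in>c ` {..<m}. val l > 0}"
  define M where "M l = Max (\<psi> ` {\<sigma>\<in>{..<m}. c \<sigma> = l})" for l
  have M: "0 \<le> M l \<and> M l \<le> 1" if l: "l \<in> c ` {..<m}" for l
  proof -
    obtain \<sigma> where \<sigma>: "\<sigma> < m" "l = c \<sigma>" using l by auto
    have "\<psi> \<sigma> \<le> M l" unfolding M_def by (rule Max_ge) (use \<sigma> in auto)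
    moreover have "M l \<le> 1" unfolding M_def by (subst Max_le_iff) (use \<sigma> \<psi> in auto)
    ultimately show ?thesis using \<psi>[OF \<sigma>(1)] by auto
  qed
  have "(\<Sum>\<theta><n. w \<theta> * Max (\<psi> ` N \<theta>)) \<le> (\<Sum>l\<in>c ` {..<m}. val l * M l)"
    using D(6)[of \<psi>] \<psi> by (simp add: M_def)
  also have "\<dots> \<le> (\<Sum>l\<in>c ` {..<m}. if val l > 0 then of_int (val l) else 0)"
  proof (intro sum_mono)
    fix l assume "l \<in> c ` {..<m}"
    then show "val l * M l \<le> (if val l > 0 then of_int (val l) else 0)"
      using M[of l] by (auto simp: mult_nonpos_nonneg mult_left_le)
  qed
  also have "\<dots> = of_int (sum val X)"
    unfolding X_def of_int_sum by (rule sum.mono_neutral_cong_right) auto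
  also have "sum val X = hits N w {..<n} rep X"
    by (rule D(7)[symmetric]) (auto simp: X_def)
  also have "of_int \<dots> = (\<Sum>\<theta><n. w \<theta> * (MAX \<sigma>\<in>N \<theta>. of_bool (val (rep \<sigma>) > 0) :: real))"
    unfolding hits_def of_int_sum
  proof (rule sum.cong[OF refl])
    fix \<theta> assume "\<theta> \<in> {..<n}"
    then have \<theta>: "N \<theta> \<subseteq> {..<m}" "N \<theta> \<noteq> {}" using N by auto
    have iff: "rep \<sigma> \<in> X \<longleftrightarrow> val (rep \<sigma>) > 0" if "\<sigma> \<in> N \<theta>" for \<sigma>
      using D(4)[of \<sigma>] \<theta> that assms(2) unfolding X_def by force
    have fin: "finite (N \<theta>)" using \<theta> finite_subset by auto
    have "Max ((\<lambda>\<sigma>. of_bool (val (rep \<sigma>) > 0)) ` N \<theta>) = (of_bool (\<exists>\<sigma>\<in>N \<theta>. rep \<sigma> \<in> X) :: real)"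
      using iff fin \<theta> by (intro Max_eqI) (auto simp: image_iff)
    then show "real_of_int (if \<exists>\<sigma>\<in>N \<theta>. rep \<sigma> \<in> X then w \<theta> else 0) =
        w \<theta> * (MAX \<sigma>\<in>N \<theta>. of_bool (val (rep \<sigma>) > 0) :: real)"
      by simp
  qed
  finally show ?thesis .
qed


section \<open>The program\<close>

abbreviation (input) "n_reg \<equiv> 2 :: nat"
abbreviation (input) "m_reg \<equiv> 3 :: nat"
abbreviation (input) "base_reg \<equiv> 4 :: nat"
abbreviation (input) "denom_reg \<equiv> 5 :: nat"
abbreviation (input) "sizes_reg \<equiv> 6 :: nat"
abbreviation (input) "size_reg \<equiv> 7 :: nat"
abbreviation (input) "state_reg \<equiv> 8 :: nat"
abbreviation (input) "signal_reg \<equiv> 9 :: nat"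
abbreviation (input) "count_reg \<equiv> 10 :: nat"
abbreviation (input) "best_reg \<equiv> 11 :: nat"
abbreviation (input) "sum_reg \<equiv> 12 :: nat"
abbreviation (input) "weight_reg \<equiv> 13 :: nat"
abbreviation (input) "rep_reg \<equiv> 14 :: nat"

text \<open>Two header cells are followed by three cells per state, so the offsets 2, 3 and 4 select
  flag, numerator and denominator.\<close>

definition state_addr :: "int \<Rightarrow> exp" where
  "state_addr i = Bin Add (Num i) (Bin Mul (Num 3) (Var state_reg))"

definition edge_addr :: exp where
  "edge_addr = Bin Add (Bin Add (Num 2) (Bin Mul (Num 3) (Var n_reg)))
     (Bin Add (Bin Mul (Var state_reg) (Var m_reg)) (Var signal_reg))"

definition rep_addr :: "nat \<Rightarrow> exp" where
  "rep_addr x = Bin Add (Var base_reg) (Var x)"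

definition val_addr :: "nat \<Rightarrow> exp" where
  "val_addr x = Bin Add (Bin Add (Var base_reg) (Var m_reg)) (Var x)"

definition common_denominator :: com where
  "common_denominator =
     Seq (assign denom_reg (Num 1))
       (for_upto state_reg n_reg
         (assign denom_reg (Bin Mul (Var denom_reg) (Mem (state_addr 4)))))"

text \<open>
  The dummy value of \<open>m\<close> is smaller than every possible value. Hence the search for a best leader
  can start with \<open>m\<close>, and a signal \<open>\<sigma>\<close> with \<open>rep \<sigma> = m\<close> never counts as positive.
\<close>

definition init_schemes :: com where
  "init_schemes =
     Seq (for_upto signal_reg m_reg (mem_write (rep_addr signal_reg) (Var signal_reg)))
       (mem_write (val_addr m_reg) (Bin Sub (Num (-1)) (Var denom_reg)))"

definition count_nbhd :: com where
  "count_nbhd =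
     Seq (assign count_reg (Num 0))
       (for_upto signal_reg m_reg
         (assign count_reg (Bin Add (Var count_reg) (Mem edge_addr))))"

definition find_best :: com where
  "find_best =
     Seq (assign best_reg (Var m_reg)) (Seq (assign sum_reg (Num 0))
       (for_upto signal_reg m_reg
         (if_pos (Mem edge_addr)
           (if_eq (Mem (rep_addr signal_reg)) (Var signal_reg)
             (Seq (if_pos (Bin Sub (Mem (val_addr signal_reg)) (Mem (val_addr best_reg)))
                     (assign best_reg (Var signal_reg)) Skip)
                  (if_pos (Mem (val_addr signal_reg))
                     (assign sum_reg (Bin Add (Var sum_reg) (Mem (val_addr signal_reg)))) Skip))
             Skip)
           Skip)))"

text \<open>Precedes the update of the value of the new leader, because its tests must see the old
  values. Asking for the label of the best leader first preserves that component even if its value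
  is not positive. A label \<open>m\<close> fails the second test by its negative dummy value and
  stays \<open>m\<close>.\<close>

definition relabel :: com where
  "relabel =
     for_upto signal_reg m_reg
       (if_pos (Mem edge_addr)
         (Seq (assign rep_reg (Mem (rep_addr signal_reg)))
           (if_eq (Var rep_reg) (Var best_reg) Skip
             (if_pos (Mem (val_addr rep_reg))
               (mem_write (rep_addr signal_reg) (Var best_reg))
               (mem_write (rep_addr signal_reg) (Var m_reg)))))
         Skip)"

text \<open>The division is exact, as the denominator of the state divides the common one. Dividing
  before multiplying keeps the intermediate results at most the common denominator.\<close>

definition update_val :: com where
  "update_val =
     Seq (assign weight_reg (Bin Mul (Mem (state_addr 3)) (Bin Div (Var denom_reg) (Mem (state_addr 4)))))
     (Seq (if_pos (Mem (state_addr 2)) Skip (assign weight_reg (Bin Sub (Num 0) (Var weight_reg))))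
       (if_pos (Var sum_reg)
         (mem_write (val_addr best_reg) (Bin Add (Var sum_reg) (Var weight_reg)))
         (mem_write (val_addr best_reg) (Bin Add (Mem (val_addr best_reg)) (Var weight_reg)))))"

text \<open>Replaces sorting: every size from 0 to \<open>m\<close> is tried in turn, and the
  neighbourhoods are counted anew for each size.\<close>

definition process_states :: com where
  "process_states =
     for_upto size_reg sizes_reg (for_upto state_reg n_reg
       (Seq count_nbhd
         (if_eq (Var count_reg) (Var size_reg) (Seq find_best (Seq relabel update_val)) Skip)))"

text \<open>The scheme takes only the values 0 and 1, so every reduced fraction has denominator
  1.\<close>

definition write_output :: com where
  "write_output =
     Seq (for_upto signal_reg m_reg
       (Seq (assign rep_reg (Mem (rep_addr signal_reg)))
         (Seq (if_pos (Mem (val_addr rep_reg))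
               (mem_write (Bin Mul (Num 2) (Var signal_reg)) (Num 1))
               (mem_write (Bin Mul (Num 2) (Var signal_reg)) (Num 0)))
           (mem_write (Bin Add (Num 1) (Bin Mul (Num 2) (Var signal_reg))) (Num 1)))))
       (assign 0 (Bin Mul (Num 2) (Var m_reg)))"

definition delegation_program :: com where
  "delegation_program =
     Seq (assign n_reg (Mem (Num 0))) (Seq (assign m_reg (Mem (Num 1)))
    (Seq (assign base_reg (Bin Add (Var 0) (Bin Mul (Num 2) (Var m_reg))))
    (Seq (assign sizes_reg (Bin Add (Var m_reg) (Num 1)))
    (Seq common_denominator (Seq init_schemes (Seq process_states write_output))))))"

section \<open>Machine states and memory layout\<close>

definition frame :: "nat set \<Rightarrow> store \<Rightarrow> store \<Rightarrow> bool" where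
  "frame X V V' \<longleftrightarrow> (\<forall>x. x \<notin> X \<longrightarrow> V' x = V x)"

lemma frame_refl: "frame X V V"
  by (simp add: frame_def)

lemma frame_upd: "frame X V V' \<Longrightarrow> x \<in> X \<Longrightarrow> frame X V (V'(x := v))"
  by (simp add: frame_def)

lemma frame_trans: "frame X V V' \<Longrightarrow> frame Y V' V'' \<Longrightarrow> X \<subseteq> Z \<Longrightarrow> Y \<subseteq> Z \<Longrightarrow> frame Z V V''"
  unfolding frame_def by (metis subsetD)

lemma row_index_less:
  fixes i j k n :: nat
  shows "i < n \<Longrightarrow> j < k \<Longrightarrow> i * k + j < n * k"
  by (metis add.commute add_less_cancel_right less_le_trans mult.commute mult_Suc mult_le_mono2 Suc_leI)

text \<open>Separates the verification of the program from the encoding of instances.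
  \<open>K\<close> bounds the rounds of all loops, strictly above \<open>m\<close> because the loop
  over sizes takes \<open>m + 1\<close> rounds; \<open>B\<close> bounds all integers and addresses.
  The assumption \<open>total\<close> comes from the probabilities having sum 1.\<close>

locale delegation_data =
  fixes n m :: nat and N :: "nat \<Rightarrow> nat set" and acc :: "nat \<Rightarrow> bool"
    and num den :: "nat \<Rightarrow> int" and B :: int and K :: nat
  assumes N: "\<And>\<theta>. \<theta> < n \<Longrightarrow> N \<theta> \<subseteq> {..<m}" "\<And>\<theta>. \<theta> < n \<Longrightarrow> N \<theta> \<noteq> {}"
    and lam: "laminar (N ` {..<n})"
    and den: "\<And>\<theta>. \<theta> < n \<Longrightarrow> den \<theta> > 0"
    and num: "\<And>\<theta>. \<theta> < n \<Longrightarrow> num \<theta> > 0"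
    and K: "n \<le> K" "m < K"
    and B_ge: "10 * int K + 10 * int (2 + 3 * n + n * m) + 50 \<le> B"
    and D_le: "4 * (\<Prod>\<theta><n. den \<theta>) + 10 \<le> B"
    and total: "(\<Sum>\<theta><n. num \<theta> * ((\<Prod>\<eta><n. den \<eta>) div den \<theta>)) \<le> (\<Prod>\<theta><n. den \<theta>)"
begin

definition D :: int where "D = (\<Prod>\<theta><n. den \<theta>)"

definition mag :: "nat \<Rightarrow> int" where "mag \<theta> = num \<theta> * (D div den \<theta>)"

definition w :: "nat \<Rightarrow> int" where "w \<theta> = (if acc \<theta> then mag \<theta> else - mag \<theta>)"

text \<open>The length of the input plus \<open>2 * m\<close>. The output fills the first
  \<open>2 * m\<close> cells, so it may overwrite the input but not the arrays for
  \<open>rep\<close> and \<open>val\<close>, which begin here.\<close>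

definition base :: nat where "base = 2 + 3 * n + n * m + 2 * m"

definition regs :: "store \<Rightarrow> bool" where
  "regs V \<longleftrightarrow> V n_reg = int n \<and> V m_reg = int m \<and> V base_reg = int base \<and>
     V denom_reg = D \<and> V sizes_reg = int m + 1"

definition input_mem :: "store \<Rightarrow> bool" where
  "input_mem M \<longleftrightarrow> M 0 = int n \<and> M 1 = int m \<and>
     (\<forall>\<theta><n. M (2 + 3 * \<theta>) = of_bool (acc \<theta>) \<and> M (3 + 3 * \<theta>) = num \<theta> \<and> M (4 + 3 * \<theta>) = den \<theta>) \<and>
     (\<forall>\<theta><n. \<forall>\<sigma><m. M (2 + 3 * n + (\<theta> * m + \<sigma>)) = of_bool (\<sigma> \<in> N \<theta>))"

definition work_mem :: "(nat \<Rightarrow> nat) \<Rightarrow> (nat \<Rightarrow> int) \<Rightarrow> store \<Rightarrow> bool" where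
  "work_mem rep val M \<longleftrightarrow>
     (\<forall>\<sigma><m. M (base + \<sigma>) = int (rep \<sigma>)) \<and> (\<forall>l\<le>m. M (base + m + l) = val l)"

lemma size_bounds:
  "10 * int K + 30 * int n + 10 * int (n * m) + 70 \<le> B" "50 \<le> B" "int K < B" "0 \<le> int (n * m)"
  "int base = 2 + 3 * int n + int (n * m) + 2 * int m" "int n \<le> int K" "int m < int K"
proof -
  show *: "10 * int K + 30 * int n + 10 * int (n * m) + 70 \<le> B" "0 \<le> int (n * m)"
    using B_ge by simp_all
  show "50 \<le> B" "int K < B" using * by linarith+
  show "int base = 2 + 3 * int n + int (n * m) + 2 * int m" by (simp add: base_def)
  show "int n \<le> int K" "int m < int K" using K by simp_all
qed

lemma input_mem_upd: "input_mem M \<Longrightarrow> base \<le> a \<Longrightarrow> input_mem (M(a := x))"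
  unfolding input_mem_def base_def using row_index_less by (auto; fastforce)

lemma work_mem_rep: "work_mem rep val M \<Longrightarrow> \<sigma> < m \<Longrightarrow> work_mem (rep(\<sigma> := r)) val (M(base + \<sigma> := int r))"
  unfolding work_mem_def by auto

lemma work_mem_val: "work_mem rep val M \<Longrightarrow> l \<le> m \<Longrightarrow> work_mem rep (val(l := v)) (M(base + m + l := v))"
  unfolding work_mem_def by auto

lemma regs_frame: "regs V \<Longrightarrow> frame X V V' \<Longrightarrow> {2, 3, 4, 5, 6} \<inter> X = {} \<Longrightarrow> regs V'"
  unfolding regs_def frame_def by simp

lemma exp_val_edge:
  assumes "regs V" "input_mem M" "V state_reg = int \<theta>" "V signal_reg = int \<sigma>" "\<theta> < n" "\<sigma> < m"
  shows "exp_val (Mem edge_addr) V M = of_bool (\<sigma> \<in> N \<theta>)" "safe B edge_addr V M"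
    "exp_val edge_addr V M \<ge> 0" "height edge_addr = 2"
proof -
  have *: "exp_val edge_addr V M = int (2 + 3 * n + (\<theta> * m + \<sigma>))"
    using assms by (simp add: edge_addr_def regs_def)
  show "exp_val (Mem edge_addr) V M = of_bool (\<sigma> \<in> N \<theta>)"
    using assms unfolding exp_val.simps * nat_int by (auto simp: input_mem_def)
  show "exp_val edge_addr V M \<ge> 0" unfolding * by simp
  show "height edge_addr = 2" by (simp add: edge_addr_def)
  have "int (\<theta> * m + \<sigma>) < int (n * m)" using row_index_less assms by (simp only: of_nat_less_iff)
  then have "int \<theta> * int m + int \<sigma> < int (n * m)" "0 \<le> int \<theta> * int m" by simp_all
  moreover have "\<bar>3 :: int\<bar> \<le> B" "\<bar>2 :: int\<bar> \<le> B" using size_bounds by linarith+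
  ultimately show "safe B edge_addr V M"
    using assms(1,3,4) size_bounds unfolding edge_addr_def regs_def safe.simps exp_val.simps arith_val.simps
    by (intro conjI; simp del: of_nat_mult; linarith)
qed

lemma exp_val_state:
  assumes "input_mem M" "V state_reg = int \<theta>" "\<theta> < n"
  shows "exp_val (Mem (state_addr 2)) V M = of_bool (acc \<theta>)"
    "exp_val (Mem (state_addr 3)) V M = num \<theta>"
    "exp_val (Mem (state_addr 4)) V M = den \<theta>"
    "0 \<le> i \<Longrightarrow> i \<le> 4 \<Longrightarrow> safe B (state_addr i) V M" "0 \<le> i \<Longrightarrow> exp_val (state_addr i) V M \<ge> 0"
    "height (state_addr i) = 2"
proof -
  have *: "exp_val (state_addr 2) V M = int (2 + 3 * \<theta>)" "exp_val (state_addr 3) V M = int (3 + 3 * \<theta>)"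
    "exp_val (state_addr 4) V M = int (4 + 3 * \<theta>)"
    using assms by (simp_all add: state_addr_def)
  show "exp_val (Mem (state_addr 2)) V M = of_bool (acc \<theta>)"
    "exp_val (Mem (state_addr 3)) V M = num \<theta>"
    "exp_val (Mem (state_addr 4)) V M = den \<theta>"
    using assms unfolding exp_val.simps * nat_int by (auto simp: input_mem_def)
  show "0 \<le> i \<Longrightarrow> i \<le> 4 \<Longrightarrow> safe B (state_addr i) V M" "0 \<le> i \<Longrightarrow> exp_val (state_addr i) V M \<ge> 0"
    "height (state_addr i) = 2"
  proof -
    have "int \<theta> < int n" using assms by simp
    then have "3 * int \<theta> \<le> B - 50" "50 \<le> B" using size_bounds by linarith+
    then show "0 \<le> i \<Longrightarrow> i \<le> 4 \<Longrightarrow> safe B (state_addr i) V M" "0 \<le> i \<Longrightarrow> exp_val (state_addr i) V M \<ge> 0"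
      "height (state_addr i) = 2"
      using assms by (simp_all add: state_addr_def)
  qed
qed

lemma exp_val_rep_addr:
  assumes "regs V" "V x = int \<sigma>" "\<sigma> \<le> m" "x < scratch"
  shows "exp_val (rep_addr x) V M = int (base + \<sigma>)" "safe B (rep_addr x) V M" "height (rep_addr x) = 1"
proof -
  have "int \<sigma> \<le> int m" using assms by simp
  then have "int base + int \<sigma> \<le> B" using size_bounds by linarith
  then show "exp_val (rep_addr x) V M = int (base + \<sigma>)" "safe B (rep_addr x) V M" "height (rep_addr x) = 1"
    using assms by (simp_all add: rep_addr_def regs_def)
qed

lemma exp_val_val_addr:
  assumes "regs V" "V x = int \<sigma>" "\<sigma> \<le> m" "x < scratch"
  shows "exp_val (val_addr x) V M = int (base + m + \<sigma>)" "safe B (val_addr x) V M" "height (val_addr x) = 1"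
proof -
  have "int \<sigma> \<le> int m" using assms by simp
  then have "int base + int m + int \<sigma> \<le> B" using size_bounds by linarith
  then show "exp_val (val_addr x) V M = int (base + m + \<sigma>)" "safe B (val_addr x) V M" "height (val_addr x) = 1"
    using assms by (simp_all add: val_addr_def regs_def)
qed

lemma exp_val_rep:
  assumes "regs V" "work_mem rep val M" "V x = int \<sigma>" "\<sigma> < m" "x < scratch"
  shows "exp_val (Mem (rep_addr x)) V M = int (rep \<sigma>)"
  using assms exp_val_rep_addr(1)[OF assms(1,3) _ assms(5), of M] unfolding exp_val.simps
  by (simp only: nat_int) (simp add: work_mem_def)

lemma exp_val_val:
  assumes "regs V" "work_mem rep val M" "V x = int \<sigma>" "\<sigma> \<le> m" "x < scratch"
  shows "exp_val (Mem (val_addr x)) V M = val \<sigma>"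
  using assms exp_val_val_addr(1)[OF assms(1,3) _ assms(5), of M] unfolding exp_val.simps
  by (simp only: nat_int) (simp add: work_mem_def)

lemma D_bounds: "1 \<le> D" "4 * D + 10 \<le> B"
proof -
  show "1 \<le> D" unfolding D_def by (rule prod_ge_1) (use den in force)
  show "4 * D + 10 \<le> B" unfolding D_def by (rule D_le)
qed

lemma mag_nonneg: "\<theta> < n \<Longrightarrow> 0 \<le> mag \<theta>"
  using num den D_bounds by (auto simp: mag_def pos_imp_zdiv_nonneg_iff less_imp_le)

text \<open>No net weight of a set of states lies below \<open>- D\<close>, which makes
  \<open>- 1 - D\<close> smaller than every value of a leader.\<close>

lemma sum_abs_w: "(\<Sum>\<theta><n. \<bar>w \<theta>\<bar>) \<le> D"
proof -
  have "(\<Sum>\<theta><n. \<bar>w \<theta>\<bar>) = (\<Sum>\<theta><n. mag \<theta>)"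
    using mag_nonneg by (intro sum.cong) (auto simp: w_def)
  also have "\<dots> \<le> D" using total by (simp add: mag_def D_def)
  finally show ?thesis .
qed

lemma mag_le: "\<theta> < n \<Longrightarrow> mag \<theta> \<le> D"
proof -
  assume "\<theta> < n"
  then have "mag \<theta> \<le> (\<Sum>\<theta><n. mag \<theta>)"
    using mag_nonneg by (intro member_le_sum) auto
  also have "\<dots> \<le> D" using total by (simp add: mag_def D_def)
  finally show ?thesis .
qed

section \<open>Correctness of the phases of the program\<close>

lemma wp_common_denominator:
  assumes "V n_reg = int n" "input_mem M"
    and Q: "\<And>V'. frame {denom_reg, state_reg} V V' \<Longrightarrow> V' denom_reg = D \<Longrightarrow> Q V' M"
  shows "wp B K common_denominator Q V M"
  unfolding common_denominator_def
proof (intro wp_Seq wp_assign)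
  let ?V = "V(denom_reg := exp_val (Num 1) V M)"
  let ?I = "\<lambda>j V' M'. M' = M \<and> frame {denom_reg, state_reg} V V' \<and> V' denom_reg = (\<Prod>\<theta><j. den \<theta>)"
  show "wp B K (for_upto state_reg n_reg
          (assign denom_reg (Bin Mul (Var denom_reg) (Mem (state_addr 4))))) Q ?V M"
  proof (rule wp_for_upto[where Inv = ?I])
    fix j V' M'
    assume j: "j < nat (?V n_reg)" and I: "?I j V' M'" and *: "V' state_reg = int j" "V' n_reg = ?V n_reg"
    have "j < n" using j assms by simp
    note S = exp_val_state[of M V', OF assms(2) *(1) this]
    \<comment> \<open>Partial products do not exceed the full product, as each denominator is at
      least 1.\<close>
    have "(\<Prod>\<theta><Suc j. den \<theta>) \<le> D" unfolding D_def
      by (rule prod_mono2) (use den \<open>j < n\<close> in \<open>auto simp: less_imp_le int_one_le_iff_zero_less\<close>)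
    moreover have "0 \<le> (\<Prod>\<theta><Suc j. den \<theta>)"
      by (rule prod_nonneg) (use den \<open>j < n\<close> in \<open>auto simp: less_imp_le\<close>)
    ultimately have "\<bar>(\<Prod>\<theta><j. den \<theta>) * den j\<bar> \<le> B"
      using D_bounds by simp
    then show "wp B K (assign denom_reg (Bin Mul (Var denom_reg) (Mem (state_addr 4))))
        (\<lambda>V'' M''. ?I (Suc j) (V''(state_reg := int (Suc j))) M'' \<and> V'' state_reg = int j \<and>
          V'' n_reg = ?V n_reg) V' M'"
      using I * S size_bounds by (intro wp_assign) (auto simp: exp_ok_def intro!: frame_upd)
  next
    fix V' M' assume "?I (nat (?V n_reg)) V' M'"
    then show "Q V' M'" using Q[of V'] assms by (auto simp: D_def)
  qed (use assms size_bounds in \<open>auto intro!: frame_upd frame_refl\<close>)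
qed (use size_bounds in \<open>auto simp: exp_ok_def\<close>)

lemma wp_init_schemes:
  assumes V: "regs V" and M: "input_mem M" "\<And>a. base \<le> a \<Longrightarrow> M a = 0"
    and Q: "\<And>V' M'. frame {signal_reg} V V' \<Longrightarrow> input_mem M' \<Longrightarrow>
      work_mem (\<lambda>\<sigma>. \<sigma>) ((\<lambda>_. 0)(m := - 1 - D)) M' \<Longrightarrow> Q V' M'"
  shows "wp B K init_schemes Q V M"
  unfolding init_schemes_def
proof (intro wp_Seq)
  let ?I = "\<lambda>j V' M'. frame {signal_reg} V V' \<and> input_mem M' \<and>
    (\<forall>\<sigma><j. M' (base + \<sigma>) = int \<sigma>) \<and> (\<forall>a\<ge>base + j. M' a = 0)"
  have Vm: "V m_reg = int m" using V by (simp add: regs_def)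
  show "wp B K (for_upto signal_reg m_reg (mem_write (rep_addr signal_reg) (Var signal_reg)))
      (wp B K (mem_write (val_addr m_reg) (Bin Sub (Num (-1)) (Var denom_reg))) Q) V M"
  proof (rule wp_for_upto[where Inv = ?I])
    fix j V' M'
    assume j: "j < nat (V m_reg)" and I: "?I j V' M'" and *: "V' signal_reg = int j" "V' m_reg = V m_reg"
    have jm: "j \<le> m" using j Vm by simp
    have "regs V'" using regs_frame[OF V, of "{signal_reg}" V'] I by simp
    note R = exp_val_rep_addr[OF this *(1) jm]
    show "wp B K (mem_write (rep_addr signal_reg) (Var signal_reg))
        (\<lambda>V'' M''. ?I (Suc j) (V''(signal_reg := int (Suc j))) M'' \<and> V'' signal_reg = int j \<and>
          V'' m_reg = V m_reg) V' M'"
    proof (intro wp_mem_write)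
      show "?I (Suc j) (V'(signal_reg := int (Suc j)))
          (M'(nat (exp_val (rep_addr signal_reg) V' M') := exp_val (Var signal_reg) V' M')) \<and>
          V' signal_reg = int j \<and> V' m_reg = V m_reg"
        using I * by (auto simp: R nat_int simp del: of_nat_add intro!: frame_upd input_mem_upd)
    qed (use R size_bounds in \<open>auto simp: exp_ok_def\<close>)
  next
    fix V' M'
    assume I: "?I (nat (V m_reg)) V' M'"
    have V': "regs V'" using regs_frame[OF V, of "{signal_reg}" V'] I by simp
    then have "V' m_reg = int m" "V' denom_reg = D" by (auto simp: regs_def)
    note R = exp_val_val_addr[OF V' this(1) order_refl]
    have work: "work_mem (\<lambda>\<sigma>. \<sigma>) (\<lambda>_. 0) M'"
      using I Vm by (auto simp: work_mem_def)
    show "wp B K (mem_write (val_addr m_reg) (Bin Sub (Num (-1)) (Var denom_reg))) Q V' M'"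
    proof (intro wp_mem_write)
      have "work_mem (\<lambda>\<sigma>. \<sigma>) ((\<lambda>_. 0)(m := - 1 - D)) (M'(base + m + m := - 1 - D))"
        by (rule work_mem_val[OF work]) simp
      then have "Q V' (M'(base + m + m := - 1 - D))"
        using I by (intro Q) (auto intro!: input_mem_upd)
      then show "Q V' (M'(nat (exp_val (val_addr m_reg) V' M') := exp_val (Bin Sub (Num (-1)) (Var denom_reg)) V' M'))"
        using \<open>V' denom_reg = D\<close> by (simp add: R nat_int del: of_nat_add)
    qed (use R size_bounds D_bounds \<open>V' denom_reg = D\<close> in \<open>auto simp: exp_ok_def\<close>)
  qed (use V Vm M size_bounds in \<open>auto intro!: frame_upd frame_refl\<close>)
qed

lemma wp_count_nbhd:
  assumes V: "regs V" "V state_reg = int \<theta>" and M: "input_mem M" and \<theta>: "\<theta> < n"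
    and Q: "\<And>V'. frame {signal_reg, count_reg} V V' \<Longrightarrow> V' count_reg = int (card (N \<theta>)) \<Longrightarrow> Q V' M"
  shows "wp B K count_nbhd Q V M"
  unfolding count_nbhd_def
proof (intro wp_Seq wp_assign)
  let ?V = "V(count_reg := exp_val (Num 0) V M)"
  let ?I = "\<lambda>j V' M'. M' = M \<and> frame {signal_reg, count_reg} V V' \<and>
    V' count_reg = int (card {\<sigma>\<in>N \<theta>. \<sigma> < j})"
  have Vm: "?V m_reg = int m" using V by (simp add: regs_def)
  have fin: "finite (N \<theta>)" using N(1)[OF \<theta>] finite_subset by auto
  show "wp B K (for_upto signal_reg m_reg (assign count_reg (Bin Add (Var count_reg) (Mem edge_addr)))) Q ?V M"
  proof (rule wp_for_upto[where Inv = ?I])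
    fix j V' M'
    assume j: "j < nat (?V m_reg)" and I: "?I j V' M'" and *: "V' signal_reg = int j" "V' m_reg = ?V m_reg"
    have jm: "j < m" using j Vm by simp
    have "regs V'" using regs_frame[OF V(1), of _ V'] I by auto
    moreover have "V' state_reg = int \<theta>" using I V by (auto simp: frame_def)
    ultimately have E: "exp_val (Mem edge_addr) V' M = of_bool (j \<in> N \<theta>)" "safe B edge_addr V' M"
        "exp_val edge_addr V' M \<ge> 0" "height edge_addr = 2"
      using exp_val_edge[of V' M \<theta> j] M *(1) \<theta> jm by auto
    have "card {\<sigma>\<in>N \<theta>. \<sigma> < Suc j} = card ({\<sigma>\<in>N \<theta>. \<sigma> < j} \<union> (if j \<in> N \<theta> then {j} else {}))"
      by (rule arg_cong[where f = card]) (auto simp: less_Suc_eq)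
    also have "\<dots> = card {\<sigma>\<in>N \<theta>. \<sigma> < j} + of_bool (j \<in> N \<theta>)"
      using fin by (subst card_Un_disjoint) auto
    finally have c: "card {\<sigma>\<in>N \<theta>. \<sigma> < Suc j} = card {\<sigma>\<in>N \<theta>. \<sigma> < j} + of_bool (j \<in> N \<theta>)" .
    have "card {\<sigma>\<in>N \<theta>. \<sigma> < Suc j} \<le> card {..<m}"
      by (rule card_mono) (use N(1)[OF \<theta>] in auto)
    then have "int (card {\<sigma>\<in>N \<theta>. \<sigma> < j}) + of_bool (j \<in> N \<theta>) \<le> B" using c size_bounds by simp
    then show "wp B K (assign count_reg (Bin Add (Var count_reg) (Mem edge_addr)))
        (\<lambda>V'' M''. ?I (Suc j) (V''(signal_reg := int (Suc j))) M'' \<and> V'' signal_reg = int j \<and>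
          V'' m_reg = ?V m_reg) V' M'"
      using I * E size_bounds c by (intro wp_assign) (auto simp: exp_ok_def intro!: frame_upd)
  next
    fix V' M' assume I: "?I (nat (?V m_reg)) V' M'"
    have "{\<sigma>\<in>N \<theta>. \<sigma> < m} = N \<theta>" using N(1)[OF \<theta>] by auto
    then show "Q V' M'" using I Q[of V'] Vm by auto
  qed (use V Vm M size_bounds in \<open>auto intro!: frame_upd frame_refl\<close>)
qed (use size_bounds in \<open>auto simp: exp_ok_def\<close>)

text \<open>The bound on sums over sets of leaders enters twice: for singletons it separates real
  values from the dummy value, and for the leaders scanned so far it keeps the running sum
  small.\<close>

lemma wp_find_best:
  assumes V: "regs V" "V state_reg = int \<theta>" and M: "input_mem M" "work_mem rep val M" and \<theta>: "\<theta> < n"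
    and val: "val m = - 1 - D" "\<And>X. X \<subseteq> {l\<in>{..<m}. rep l = l} \<Longrightarrow> \<bar>sum val X\<bar> \<le> D"
    and ex: "\<exists>l\<in>N \<theta>. rep l = l" and rep: "\<And>\<sigma>. \<sigma> < m \<Longrightarrow> rep \<sigma> \<le> m"
    and Q: "\<And>V' b. frame {signal_reg, best_reg, sum_reg} V V' \<Longrightarrow> V' best_reg = int b \<Longrightarrow>
      b \<in> N \<theta> \<Longrightarrow> rep b = b \<Longrightarrow> (\<And>l. l \<in> N \<theta> \<Longrightarrow> rep l = l \<Longrightarrow> val l \<le> val b) \<Longrightarrow>
      V' sum_reg = sum val {l\<in>N \<theta>. rep l = l \<and> val l > 0} \<Longrightarrow> Q V' M"
  shows "wp B K find_best Q V M"
  unfolding find_best_def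
proof (intro wp_Seq wp_assign)
  define S where "S j = {l\<in>N \<theta>. l < j \<and> rep l = l \<and> val l > 0}" for j
  let ?V1 = "V(best_reg := exp_val (Var m_reg) V M)"
  let ?V = "?V1(sum_reg := exp_val (Num 0) ?V1 M)"
  let ?X = "{signal_reg, best_reg, sum_reg}"
  \<comment> \<open>Until a leader inside \<open>N \<theta>\<close> is met, the candidate is the
    dummy index \<open>m\<close>.\<close>
  let ?J = "\<lambda>j b. b \<le> m \<and> (b = m \<or> b \<in> N \<theta> \<and> rep b = b) \<and>
      (\<forall>l\<in>N \<theta>. l < j \<longrightarrow> rep l = l \<longrightarrow> val l \<le> val b)"
  let ?I = "\<lambda>j V' M'. M' = M \<and> frame ?X V V' \<and>
      (\<exists>b. V' best_reg = int b \<and> ?J j b) \<and> V' sum_reg = sum val (S j)"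
  have Vm: "V m_reg = int m" "?V m_reg = int m" using V by (simp_all add: regs_def)
  have N_lt: "\<sigma> < m" if "\<sigma> \<in> N \<theta>" for \<sigma> using N(1)[OF \<theta>] that by auto
  have val_le: "\<bar>val l\<bar> \<le> D" if "l < m" "rep l = l" for l
    using val(2)[of "{l}"] that by simp
  have fin: "finite (N \<theta>)" using N(1)[OF \<theta>] finite_subset by auto
  have finS: "finite (S j)" for j using fin by (simp add: S_def)
  have S_le: "\<bar>sum val (S j)\<bar> \<le> D" for j
    by (rule val(2)) (use N_lt in \<open>auto simp: S_def\<close>)
  have S_Suc: "S (Suc j) = (if j \<in> N \<theta> \<and> rep j = j \<and> val j > 0 then insert j (S j) else S j)" for j
    by (auto simp: S_def less_Suc_eq)
  have S_notin: "j \<notin> S j" for j by (simp add: S_def)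
  show "wp B K (for_upto signal_reg m_reg
         (if_pos (Mem edge_addr)
           (if_eq (Mem (rep_addr signal_reg)) (Var signal_reg)
             (Seq (if_pos (Bin Sub (Mem (val_addr signal_reg)) (Mem (val_addr best_reg)))
                     (assign best_reg (Var signal_reg)) Skip)
                  (if_pos (Mem (val_addr signal_reg))
                     (assign sum_reg (Bin Add (Var sum_reg) (Mem (val_addr signal_reg)))) Skip))
             Skip)
           Skip)) Q ?V M"
  proof (rule wp_for_upto[where Inv = ?I])
    fix j V' M'
    assume j: "j < nat (?V m_reg)" and I: "?I j V' M'" and *: "V' signal_reg = int j" "V' m_reg = ?V m_reg"
    let ?Q = "\<lambda>V'' M''. ?I (Suc j) (V''(signal_reg := int (Suc j))) M'' \<and>
      V'' signal_reg = int j \<and> V'' m_reg = ?V m_reg"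
    from I obtain b where b: "V' best_reg = int b" "?J j b" by blast
    have jm: "j < m" using j Vm by simp
    have V': "regs V'" using regs_frame[OF V(1), of _ V'] I by auto
    have st: "V' state_reg = int \<theta>" using I V by (auto simp: frame_def)
    note E = exp_val_edge[OF V' M(1) st *(1) \<theta> jm]
    note R = exp_val_rep[OF V' M(2) *(1) jm] exp_val_rep_addr[OF V' *(1)]
    note L = exp_val_val[OF V' M(2) *(1)] exp_val_val_addr[OF V' *(1)]
    have skip: "?Q V' M" if "\<not> (j \<in> N \<theta> \<and> rep j = j)"
      using I b * that by (auto simp: S_Suc less_Suc_eq intro!: frame_upd)
    have second: "wp B K (if_pos (Mem (val_addr signal_reg))
                     (assign sum_reg (Bin Add (Var sum_reg) (Mem (val_addr signal_reg)))) Skip) ?Q V1 M"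
      if V1: "frame ?X V V1" "V1 best_reg = int best'" "?J (Suc j) best'" "V1 sum_reg = sum val (S j)"
        "V1 signal_reg = int j" and leader: "j \<in> N \<theta>" "rep j = j" for V1 best'
    proof -
      have regs: "regs V1" using regs_frame[OF V(1) V1(1)] by simp
      have m: "V1 m_reg = int m" using regs by (simp add: regs_def)
      note L1 = exp_val_val[OF regs M(2) V1(5)] exp_val_val_addr[OF regs V1(5)]
      have sum: "sum val (S (Suc j)) = (if val j > 0 then sum val (S j) + val j else sum val (S j))"
        using leader finS S_notin by (simp add: S_Suc)
      have "\<bar>sum val (S j) + val j\<bar> \<le> B" if "val j > 0"
        using S_le[of "Suc j"] D_bounds that by (simp add: sum)
      moreover have "frame ?X V (V1(sum_reg := x, signal_reg := y))" "frame ?X V (V1(signal_reg := y))" for x y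
        using V1(1) by (auto intro!: frame_upd)
      ultimately show ?thesis
        using V1 L1 jm size_bounds sum m Vm by (intro wp_if_pos wp_assign wp_Skip) (auto simp: exp_ok_def)
    qed
    have both: "wp B K (Seq (if_pos (Bin Sub (Mem (val_addr signal_reg)) (Mem (val_addr best_reg)))
                     (assign best_reg (Var signal_reg)) Skip)
                  (if_pos (Mem (val_addr signal_reg))
                     (assign sum_reg (Bin Add (Var sum_reg) (Mem (val_addr signal_reg)))) Skip)) ?Q V' M"
      if leader: "j \<in> N \<theta>" "rep j = j"
    proof (rule wp_Seq, rule wp_if_pos)
      have bm: "b \<le> m" using b by simp
      note Lb = exp_val_val[OF V' M(2) b(1) bm] exp_val_val_addr[OF V' b(1) bm]
      have "\<bar>val b\<bar> \<le> D + 1" using val_le[of b] N_lt[of b] b(2) val(1) D_bounds by force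
      moreover have "\<bar>val j\<bar> \<le> D" using val_le jm leader by simp
      ultimately show "exp_ok B (Bin Sub (Mem (val_addr signal_reg)) (Mem (val_addr best_reg))) V' M"
        using L Lb jm size_bounds D_bounds by (simp add: exp_ok_def)
      show "wp B K (assign best_reg (Var signal_reg)) (wp B K (if_pos (Mem (val_addr signal_reg))
             (assign sum_reg (Bin Add (Var sum_reg) (Mem (val_addr signal_reg)))) Skip) ?Q) V' M"
        if "0 < exp_val (Bin Sub (Mem (val_addr signal_reg)) (Mem (val_addr best_reg))) V' M"
      proof (rule wp_assign, rule_tac [3] second[where best' = j])
        have "val b < val j" using that L Lb jm by simp
        then show "?J (Suc j) j" using b(2) jm leader by (auto simp: less_Suc_eq intro: order.trans)
      qed (use I * leader size_bounds(2) in \<open>auto simp: exp_ok_def intro!: frame_upd\<close>)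
      show "wp B K Skip (wp B K (if_pos (Mem (val_addr signal_reg))
             (assign sum_reg (Bin Add (Var sum_reg) (Mem (val_addr signal_reg)))) Skip) ?Q) V' M"
        if "exp_val (Bin Sub (Mem (val_addr signal_reg)) (Mem (val_addr best_reg))) V' M \<le> 0"
      proof (rule wp_Skip, rule second[where best' = b])
        have "val j \<le> val b" using that L Lb jm by simp
        then show "?J (Suc j) b" using b(2) by (auto simp: less_Suc_eq)
      qed (use I b * leader in \<open>auto\<close>)
    qed
    have M': "M' = M" using I by simp
    have small: "\<bar>int (rep j) - int j\<bar> \<le> B" "\<bar>int j - int (rep j)\<bar> \<le> B"
      using size_bounds rep[OF jm] jm by linarith+
    show "wp B K (if_pos (Mem edge_addr)
           (if_eq (Mem (rep_addr signal_reg)) (Var signal_reg)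
             (Seq (if_pos (Bin Sub (Mem (val_addr signal_reg)) (Mem (val_addr best_reg)))
                     (assign best_reg (Var signal_reg)) Skip)
                  (if_pos (Mem (val_addr signal_reg))
                     (assign sum_reg (Bin Add (Var sum_reg) (Mem (val_addr signal_reg)))) Skip))
             Skip)
           Skip) ?Q V' M'"
      unfolding M'
      by (intro wp_if_pos wp_if_eq wp_Skip both skip)
        (use E R jm * small size_bounds in \<open>auto simp: exp_ok_def\<close>)
  next
    fix V' M' assume I: "?I (nat (?V m_reg)) V' M'"
    then obtain b where b: "V' best_reg = int b" "?J m b" using Vm by auto
    obtain l where l: "l \<in> N \<theta>" "rep l = l" using ex by blast
    \<comment> \<open>The value of an existing leader is at least \<open>- D\<close>, so the dummy
      cannot be a maximiser at the end of the scan.\<close>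
    then have "b \<noteq> m" using b(2) val(1) val_le[of l] N_lt[of l] by force
    moreover have "S m = {l\<in>N \<theta>. rep l = l \<and> val l > 0}" using N_lt by (auto simp: S_def)
    ultimately show "Q V' M'" using I Q[of V' b] b N_lt Vm by auto
  qed (use V Vm M size_bounds val in \<open>auto simp: S_def intro!: frame_upd frame_refl exI[of _ m]\<close>)
qed (use size_bounds in \<open>auto simp: exp_ok_def\<close>)

definition relabelled :: "nat \<Rightarrow> (nat \<Rightarrow> nat) \<Rightarrow> (nat \<Rightarrow> int) \<Rightarrow> nat \<Rightarrow> nat \<Rightarrow> nat" where
  "relabelled \<theta> rep val b = (\<lambda>\<sigma>. if \<sigma> \<in> N \<theta>
     then if rep \<sigma> = b \<or> rep \<sigma> < m \<and> val (rep \<sigma>) > 0 then b else m else rep \<sigma>)"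

lemma wp_relabel:
  assumes V: "regs V" "V state_reg = int \<theta>" "V best_reg = int b"
    and M: "input_mem M" "work_mem rep val M" and \<theta>: "\<theta> < n" and b: "b < m"
    and val: "val m \<le> 0" and rep: "\<And>\<sigma>. \<sigma> < m \<Longrightarrow> rep \<sigma> \<le> m"
    and Q: "\<And>V' M'. frame {signal_reg, rep_reg} V V' \<Longrightarrow> input_mem M' \<Longrightarrow>
      work_mem (relabelled \<theta> rep val b) val M' \<Longrightarrow> Q V' M'"
  shows "wp B K relabel Q V M"
  unfolding relabel_def
proof -
  \<comment> \<open>New labels for the signals already scanned, old ones for the rest. Hence signal
    \<open>j\<close> is still read with its old label in round \<open>j\<close>.\<close>
  define rel where "rel j = (\<lambda>\<sigma>. if \<sigma> < j then relabelled \<theta> rep val b \<sigma> else rep \<sigma>)" for j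
  let ?X = "{signal_reg, rep_reg}"
  let ?I = "\<lambda>j V' M'. frame ?X V V' \<and> input_mem M' \<and> work_mem (rel j) val M'"
  have Vm: "V m_reg = int m" using V by (simp add: regs_def)
  have rel_Suc: "rel (Suc j) = (rel j)(j := relabelled \<theta> rep val b j)" for j
    by (auto simp: rel_def less_Suc_eq)
  show "wp B K (for_upto signal_reg m_reg
       (if_pos (Mem edge_addr)
         (Seq (assign rep_reg (Mem (rep_addr signal_reg)))
           (if_eq (Var rep_reg) (Var best_reg) Skip
             (if_pos (Mem (val_addr rep_reg))
               (mem_write (rep_addr signal_reg) (Var best_reg))
               (mem_write (rep_addr signal_reg) (Var m_reg)))))
         Skip)) Q V M"
  proof (rule wp_for_upto[where Inv = ?I])
    fix j V' M'
    assume j: "j < nat (V m_reg)" and I: "?I j V' M'" and *: "V' signal_reg = int j" "V' m_reg = V m_reg"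
    let ?Q = "\<lambda>V'' M''. ?I (Suc j) (V''(signal_reg := int (Suc j))) M'' \<and>
      V'' signal_reg = int j \<and> V'' m_reg = V m_reg"
    have M': "input_mem M'" "work_mem (rel j) val M'" using I by auto
    have jm: "j < m" using j Vm by simp
    have V': "regs V'" using regs_frame[OF V(1), of _ V'] I by auto
    have st: "V' state_reg = int \<theta>" "V' best_reg = int b" using I V by (auto simp: frame_def)
    note E = exp_val_edge[OF V' M'(1) st(1) *(1) \<theta> jm]
    note R = exp_val_rep[OF V' M'(2) *(1) jm] exp_val_rep_addr[OF V' *(1)]
    have rel_j: "rel j j = rep j" by (simp add: rel_def)
    have unchanged: "rel (Suc j) = rel j" if "relabelled \<theta> rep val b j = rep j"
      using that rel_j by (simp add: rel_Suc fun_upd_idem)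
    define V1 where "V1 = V'(rep_reg := int (rep j))"
    have V1: "regs V1" "V1 signal_reg = int j" "V1 rep_reg = int (rep j)" "V1 best_reg = int b"
      "V1 m_reg = int m" "frame ?X V V1"
      using V' * st I Vm by (auto simp: V1_def regs_def intro!: frame_upd)
    note R1 = exp_val_rep_addr[OF V1(1,2)]
    note L1 = exp_val_val[OF V1(1) M'(2) V1(3) rep[OF jm]] exp_val_val_addr[OF V1(1,3) rep[OF jm]]
    have small: "int b \<le> B" "int (rep j) \<le> B" "int m \<le> B"
      using size_bounds b rep[OF jm] by linarith+
    have rewrite: "wp B K (mem_write (rep_addr signal_reg) (Var x)) ?Q V1 M'"
      if "V1 x = int (relabelled \<theta> rep val b j)" "x < scratch" for x
    proof (intro wp_mem_write)
      have "work_mem (rel (Suc j)) val (M'(base + j := V1 x))"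
        unfolding rel_Suc that by (rule work_mem_rep[OF M'(2) jm])
      moreover have "input_mem (M'(base + j := V1 x))"
        by (rule input_mem_upd[OF M'(1)]) simp
      ultimately show "?Q V1 (M'(nat (exp_val (rep_addr signal_reg) V1 M') := exp_val (Var x) V1 M'))"
        using V1 jm Vm by (auto simp: R1 nat_int simp del: of_nat_add intro!: frame_upd)
    qed (use R1 that jm size_bounds in \<open>auto simp: exp_ok_def\<close>)
    have inner: "wp B K (if_eq (Var rep_reg) (Var best_reg) Skip
             (if_pos (Mem (val_addr rep_reg))
               (mem_write (rep_addr signal_reg) (Var best_reg))
               (mem_write (rep_addr signal_reg) (Var m_reg)))) ?Q V1 M'" if "j \<in> N \<theta>"
    proof (intro wp_if_eq wp_if_pos rewrite wp_Skip)
      assume "exp_val (Var rep_reg) V1 M' = exp_val (Var best_reg) V1 M'"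
      then have "rel (Suc j) = rel j"
        using V1 that by (intro unchanged) (simp add: relabelled_def)
      then show "?Q V1 M'" using V1 Vm M' by (auto intro!: frame_upd)
    next
      assume "exp_val (Var rep_reg) V1 M' \<noteq> exp_val (Var best_reg) V1 M'"
        and pos: "0 < exp_val (Mem (val_addr rep_reg)) V1 M'"
      then have "val (rep j) > 0" using L1 by simp
      moreover from this have "rep j < m" using rep[OF jm] val by (cases "rep j = m") auto
      ultimately show "V1 best_reg = int (relabelled \<theta> rep val b j)"
        using that V1 by (simp add: relabelled_def)
    next
      assume "exp_val (Var rep_reg) V1 M' \<noteq> exp_val (Var best_reg) V1 M'"
        and nonpos: "exp_val (Mem (val_addr rep_reg)) V1 M' \<le> 0"
      then have "val (rep j) \<le> 0" "rep j \<noteq> b" using L1 V1 by simp_all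
      then show "V1 m_reg = int (relabelled \<theta> rep val b j)"
        using that V1 by (simp add: relabelled_def)
    next
      show "exp_ok B (Bin Sub (Var rep_reg) (Var best_reg)) V1 M'"
        "exp_ok B (Bin Sub (Var best_reg) (Var rep_reg)) V1 M'"
        using small V1 size_bounds(2) by (auto simp: exp_ok_def)
      show "exp_ok B (Mem (val_addr rep_reg)) V1 M'"
        using L1 size_bounds(2) by (simp add: exp_ok_def)
    qed simp_all
    show "wp B K (if_pos (Mem edge_addr)
         (Seq (assign rep_reg (Mem (rep_addr signal_reg)))
           (if_eq (Var rep_reg) (Var best_reg) Skip
             (if_pos (Mem (val_addr rep_reg))
               (mem_write (rep_addr signal_reg) (Var best_reg))
               (mem_write (rep_addr signal_reg) (Var m_reg)))))
         Skip) ?Q V' M'"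
    proof (intro wp_if_pos wp_Seq wp_assign wp_Skip)
      assume "0 < exp_val (Mem edge_addr) V' M'"
      then show "wp B K (if_eq (Var rep_reg) (Var best_reg) Skip
             (if_pos (Mem (val_addr rep_reg))
               (mem_write (rep_addr signal_reg) (Var best_reg))
               (mem_write (rep_addr signal_reg) (Var m_reg)))) ?Q
            (V'(rep_reg := exp_val (Mem (rep_addr signal_reg)) V' M')) M'"
        using inner E R rel_j by (simp add: V1_def)
    next
      assume "exp_val (Mem edge_addr) V' M' \<le> 0"
      then have "j \<notin> N \<theta>" using E by (cases "j \<in> N \<theta>") simp_all
      then have "rel (Suc j) = rel j" by (intro unchanged) (simp add: relabelled_def)
      then show "?Q V' M'" using I * by (auto intro!: frame_upd)
    qed (use E R jm size_bounds in \<open>auto simp: exp_ok_def\<close>)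
  next
    fix V' M' assume I: "?I (nat (V m_reg)) V' M'"
    have "work_mem (relabelled \<theta> rep val b) val M'"
      using I Vm by (auto simp: work_mem_def rel_def)
    then show "Q V' M'" using I Q[of V' M'] by auto
  qed (use V Vm M size_bounds in \<open>auto simp: rel_def intro!: frame_upd frame_refl\<close>)
qed

lemma wp_update_val:
  assumes V: "regs V" "V state_reg = int \<theta>" "V best_reg = int b" "V sum_reg = s"
    and M: "input_mem M" "work_mem rep val M" and \<theta>: "\<theta> < n" and b: "b < m"
    and s: "\<bar>s\<bar> \<le> D" "\<bar>val b\<bar> \<le> D"
    and Q: "\<And>V' M'. frame {weight_reg} V V' \<Longrightarrow> input_mem M' \<Longrightarrow>
      work_mem rep (val(b := (if s > 0 then s else val b) + w \<theta>)) M' \<Longrightarrow> Q V' M'"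
  shows "wp B K update_val Q V M"
  unfolding update_val_def
proof (intro wp_Seq wp_assign)
  note S = exp_val_state[of M, OF M(1) _ \<theta>]
  have D: "V denom_reg = D" using V by (simp add: regs_def)
  let ?e = "Bin Mul (Mem (state_addr 3)) (Bin Div (Var denom_reg) (Mem (state_addr 4)))"
  let ?V = "V(weight_reg := exp_val ?e V M)"
  have e: "exp_val ?e V M = mag \<theta>" using S[of V] V D by (simp add: mag_def)
  have mag: "0 \<le> mag \<theta>" "mag \<theta> \<le> D" using mag_nonneg mag_le \<theta> by auto
  have "D div den \<theta> \<le> D" "0 \<le> D div den \<theta>"
    using D_bounds den[OF \<theta>] zdiv_mono2[of D 1 "den \<theta>"] by (auto simp: pos_imp_zdiv_nonneg_iff)
  then show "exp_ok B ?e V M"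
    using S[of V] V e mag D size_bounds D_bounds by (auto simp: exp_ok_def)
  have "wp B K (if_pos (Var sum_reg)
         (mem_write (val_addr best_reg) (Bin Add (Var sum_reg) (Var weight_reg)))
         (mem_write (val_addr best_reg) (Bin Add (Mem (val_addr best_reg)) (Var weight_reg)))) Q V' M"
    if V': "frame {weight_reg} V V'" "V' weight_reg = w \<theta>" for V'
  proof -
    have w: "\<bar>w \<theta>\<bar> \<le> D" using mag by (simp add: w_def)
    have regs: "regs V'" using regs_frame[OF V(1) V'(1)] by simp
    have V'b: "V' best_reg = int b" "V' sum_reg = s" using V V'(1) by (auto simp: frame_def)
    have bm: "b \<le> m" using b by simp
    note L = exp_val_val[OF regs M(2) V'b(1) bm] exp_val_val_addr[OF regs V'b(1) bm]
    have work: "input_mem (M(base + m + b := x))" "work_mem rep (val(b := x)) (M(base + m + b := x))" for x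
      using input_mem_upd[OF M(1)] work_mem_val[OF M(2) bm] by simp_all
    have Q': "Q V' (M(base + m + b := (if s > 0 then s else val b) + w \<theta>))"
      by (intro Q V' work)
    have small: "\<bar>s + w \<theta>\<bar> \<le> B" "\<bar>val b + w \<theta>\<bar> \<le> B" "50 \<le> B"
      using w s D_bounds size_bounds by linarith+
    show ?thesis
      by (intro wp_if_pos wp_mem_write)
        (use Q' L V' V'b small in \<open>auto simp: exp_ok_def nat_int simp del: of_nat_add\<close>)
  qed
  note store = this
  show "wp B K (if_pos (Mem (state_addr 2)) Skip (assign weight_reg (Bin Sub (Num 0) (Var weight_reg))))
     (wp B K (if_pos (Var sum_reg)
         (mem_write (val_addr best_reg) (Bin Add (Var sum_reg) (Var weight_reg)))
         (mem_write (val_addr best_reg) (Bin Add (Mem (val_addr best_reg)) (Var weight_reg)))) Q) ?V M"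
    (is "wp B K _ ?Q _ _")
  proof (rule wp_if_pos)
    have V: "?V state_reg = int \<theta>" "?V weight_reg = mag \<theta>" using V e by simp_all
    note S = S[where V = ?V, OF V(1)]
    show "exp_ok B (Mem (state_addr 2)) ?V M"
      using S(4,5,6)[of 2] size_bounds(2) by (simp add: exp_ok_def)
    assume "0 < exp_val (Mem (state_addr 2)) ?V M"
    then have "?V weight_reg = w \<theta>" using S(1) V by (cases "acc \<theta>") (simp_all add: w_def)
    then show "wp B K Skip ?Q ?V M"
      by (intro wp_Skip store) (simp_all add: frame_def)
  next
    have V: "?V state_reg = int \<theta>" "?V weight_reg = mag \<theta>" using V e by simp_all
    note S = S[where V = ?V, OF V(1)]
    let ?e' = "Bin Sub (Num 0) (Var weight_reg)"
    assume "exp_val (Mem (state_addr 2)) ?V M \<le> 0"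
    then have "(?V(weight_reg := exp_val ?e' ?V M)) weight_reg = w \<theta>" using S(1) V by (cases "acc \<theta>") (simp_all add: w_def)
    moreover have "exp_ok B ?e' ?V M"
      using V mag D_bounds size_bounds(2) by (simp add: exp_ok_def)
    ultimately show "wp B K (assign weight_reg ?e') ?Q ?V M"
      by (intro wp_assign store) (simp_all add: frame_def)
  qed
qed simp_all

text \<open>The dummy value is listed separately because \<open>best_schemes\<close> says nothing
  about \<open>val m\<close>.\<close>

definition solved :: "nat set \<Rightarrow> store \<Rightarrow> store \<Rightarrow> bool" where
  "solved P V M \<longleftrightarrow> regs V \<and> input_mem M \<and>
     (\<exists>c rep val. work_mem rep val M \<and> val m = - 1 - D \<and> best_schemes n m N w P c rep val)"

lemma solved_frame: "solved P V M \<Longrightarrow> frame X V V' \<Longrightarrow> {2, 3, 4, 5, 6} \<inter> X = {} \<Longrightarrow> solved P V' M"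
  unfolding solved_def using regs_frame[of V X V'] by metis

lemma wp_process_state:
  assumes sol: "solved P V M" and V: "V state_reg = int \<theta>" and \<theta>: "\<theta> < n" "\<theta> \<notin> P"
    and P: "P \<subseteq> {..<n}" and minimal: "\<And>\<eta>. \<eta> < n \<Longrightarrow> \<eta> \<notin> P \<Longrightarrow> card (N \<theta>) \<le> card (N \<eta>)"
    and Q: "\<And>V' M'. frame {9..<scratch} V V' \<Longrightarrow> solved (insert \<theta> P) V' M' \<Longrightarrow> Q V' M'"
  shows "wp B K (Seq find_best (Seq relabel update_val)) Q V M"
proof -
  obtain c rep val where *: "regs V" "input_mem M" "work_mem rep val M" "val m = - 1 - D"
      and inv: "best_schemes n m N w P c rep val"
    using sol unfolding solved_def by blast
  note I = best_schemesD[OF inv]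
  have N_lt: "\<sigma> < m" if "\<sigma> \<in> N \<theta>" for \<sigma> using N(1)[OF \<theta>(1)] that by auto
  have bound: "\<bar>sum val X\<bar> \<le> D" if "X \<subseteq> {l\<in>{..<m}. rep l = l}" for X
    using best_schemes_bound[OF inv P that] sum_abs_w by linarith
  have rep_le: "rep \<sigma> \<le> m" if "\<sigma> < m" for \<sigma>
    using I(1,4)[OF that] by auto
  obtain \<sigma> where \<sigma>: "\<sigma> \<in> N \<theta>" using N(2)[OF \<theta>(1)] by blast
  \<comment> \<open>An unprocessed neighbourhood contains the component of each of its signals,
    hence also its leader.\<close>
  have "c \<sigma> \<in> N \<theta>" "rep (c \<sigma>) = c \<sigma>"
    using I(5)[OF \<theta> \<sigma>] I(1-3)[OF N_lt[OF \<sigma>]] by auto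
  then have ex: "\<exists>l\<in>N \<theta>. rep l = l" by blast
  show ?thesis
  proof (rule wp_Seq, rule wp_find_best[OF *(1) V *(2,3) \<theta>(1) *(4) bound ex rep_le])
    fix V1 b
    define s where "s = sum val {l\<in>N \<theta>. rep l = l \<and> val l > 0}"
    assume V1: "frame {signal_reg, best_reg, sum_reg} V V1" "V1 best_reg = int b"
      "V1 sum_reg = sum val {l\<in>N \<theta>. rep l = l \<and> val l > 0}"
      and b: "b \<in> N \<theta>" "rep b = b" "\<And>l. l \<in> N \<theta> \<Longrightarrow> rep l = l \<Longrightarrow> val l \<le> val b"
    have "regs V1" "V1 state_reg = int \<theta>" using regs_frame[OF *(1) V1(1)] V V1(1) by (auto simp: frame_def)
    note V1' = this V1(2)
    have bm: "b < m" using b N_lt by simp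
    have "val m \<le> 0" using *(4) D_bounds by simp
    note step = best_schemes_step[OF inv N(1) lam P \<theta> minimal b s_def, folded relabelled_def]
    show "wp B K (Seq relabel update_val) Q V1 M"
    proof (rule wp_Seq, rule wp_relabel[OF V1' *(2,3) \<theta>(1) bm \<open>val m \<le> 0\<close> rep_le])
      fix V2 M2
      assume V2: "frame {signal_reg, rep_reg} V1 V2"
        and M2: "input_mem M2" "work_mem (relabelled \<theta> rep val b) val M2"
      have V2': "regs V2" "V2 state_reg = int \<theta>" "V2 best_reg = int b" "V2 sum_reg = s"
        using regs_frame[OF V1'(1) V2] V1' V1(3) V2 by (auto simp: frame_def s_def)
      have "\<bar>s\<bar> \<le> D" "\<bar>val b\<bar> \<le> D"
        using bound[of "{b}"] bm b N_lt unfolding s_def by (auto intro!: bound)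
      then show "wp B K update_val Q V2 M2"
      proof (rule wp_update_val[OF V2' M2 \<theta>(1) bm])
        fix V3 M3
        assume V3: "frame {weight_reg} V2 V3" and M3: "input_mem M3"
          "work_mem (relabelled \<theta> rep val b) (val(b := (if 0 < s then s else val b) + w \<theta>)) M3"
        have "frame {9..<scratch} V1 V3" by (rule frame_trans[OF V2 V3]) auto
        then have fr: "frame {9..<scratch} V V3" by (rule frame_trans[OF V1(1)]) auto
        have "regs V3" using regs_frame[OF V2'(1) V3] by simp
        moreover have "(val(b := (if 0 < s then s else val b) + w \<theta>)) m = - 1 - D"
          using *(4) bm by simp
        ultimately have "solved (insert \<theta> P) V3 M3"
          using M3 step unfolding solved_def by (intro conjI exI) assumption+
        then show "Q V3 M3" using Q fr by blast
      qed
    qed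
  qed
qed

text \<open>The states preceding the pair \<open>(k, j)\<close> in the lexicographic order by
  neighbourhood size and number, in which the two nested loops visit them. All states outside
  therefore have neighbourhoods of size at least \<open>k\<close>.\<close>

definition processed :: "nat \<Rightarrow> nat \<Rightarrow> nat set" where
  "processed k j = {\<theta>\<in>{..<n}. card (N \<theta>) < k \<or> card (N \<theta>) = k \<and> \<theta> < j}"

lemma wp_process_states:
  assumes sol: "solved {} V M"
    and Q: "\<And>V' M'. solved {..<n} V' M' \<Longrightarrow> Q V' M'"
  shows "wp B K process_states Q V M"
  unfolding process_states_def
proof (rule wp_for_upto[where Inv = "\<lambda>k. solved (processed k 0)"])
  have V: "V sizes_reg = int m + 1" using sol by (simp add: solved_def regs_def)
  have N_card: "0 < card (N \<theta>)" "card (N \<theta>) \<le> m" if "\<theta> < n" for \<theta>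
    using N[OF that] card_mono[of "{..<m}" "N \<theta>"] finite_subset[of "N \<theta>" "{..<m}"] by (auto simp: card_gt_0_iff)
  show "solved (processed 0 0) (V(size_reg := 0)) M"
    using solved_frame[OF sol, of "{size_reg}"] frame_upd[OF frame_refl] by (simp add: processed_def)
  show "0 \<le> V sizes_reg" "V sizes_reg \<le> int K" using V K by simp_all
  fix k V1 M1
  assume k: "k < nat (V sizes_reg)" and sol1: "solved (processed k 0) V1 M1"
    and V1: "V1 size_reg = int k" "V1 sizes_reg = V sizes_reg"
  let ?Q = "\<lambda>V'' M''. solved (processed (Suc k) 0) (V''(size_reg := int (Suc k))) M'' \<and>
    V'' size_reg = int k \<and> V'' sizes_reg = V sizes_reg"
  have V1n: "V1 n_reg = int n" using sol1 by (simp add: solved_def regs_def)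
  show "wp B K (for_upto state_reg n_reg (Seq count_nbhd
      (if_eq (Var count_reg) (Var size_reg) (Seq find_best (Seq relabel update_val)) Skip))) ?Q V1 M1"
  proof (rule wp_for_upto[where Inv = "\<lambda>j V' M'. solved (processed k j) V' M' \<and> V' size_reg = int k"])
    show "solved (processed k 0) (V1(state_reg := 0)) M1 \<and> (V1(state_reg := 0)) size_reg = int k"
      using solved_frame[OF sol1, of "{state_reg}"] frame_upd[OF frame_refl] V1 by simp
    show "0 \<le> V1 n_reg" "V1 n_reg \<le> int K" using V1n K by simp_all
    fix j V2 M2
    assume j: "j < nat (V1 n_reg)" and sol2: "solved (processed k j) V2 M2 \<and> V2 size_reg = int k"
      and V2: "V2 state_reg = int j" "V2 n_reg = V1 n_reg"
    let ?Q = "\<lambda>V'' M''. (solved (processed k (Suc j)) (V''(state_reg := int (Suc j))) M'' \<and>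
        (V''(state_reg := int (Suc j))) size_reg = int k) \<and> V'' state_reg = int j \<and> V'' n_reg = V1 n_reg"
    have jn: "j < n" using j V1n by simp
    have V2': "regs V2" "input_mem M2" using sol2 by (auto simp: solved_def)
    have Q: "?Q V4 M4" if "solved (processed k (Suc j)) V4 M4" "frame {9..<scratch} V2 V4" for V4 M4
      using solved_frame[OF that(1), of "{state_reg}"] frame_upd[OF frame_refl] that(2) sol2 V2
      by (simp add: frame_def)
    show "wp B K (Seq count_nbhd (if_eq (Var count_reg) (Var size_reg) (Seq find_best (Seq relabel update_val)) Skip)) ?Q V2 M2"
    proof (rule wp_Seq, rule wp_count_nbhd[OF V2'(1) V2(1) V2'(2) jn])
      fix V3
      assume V3: "frame {signal_reg, count_reg} V2 V3" "V3 count_reg = int (card (N j))"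
      have sol3: "solved (processed k j) V3 M2"
        using solved_frame[OF _ V3(1)] sol2 by simp
      have V3': "V3 state_reg = int j" "V3 size_reg = int k" using V3 V2 sol2 by (auto simp: frame_def)
      have fr: "frame {9..<scratch} V2 V4" if "frame {9..<scratch} V3 V4" for V4
        by (rule frame_trans[OF V3(1) that]) auto
      have small: "int k \<le> B" "int (card (N j)) \<le> B" using k V N_card(2)[OF jn] size_bounds by linarith+
      show "wp B K (if_eq (Var count_reg) (Var size_reg) (Seq find_best (Seq relabel update_val)) Skip) ?Q V3 M2"
      proof (rule wp_if_eq)
        show "exp_ok B (Bin Sub (Var count_reg) (Var size_reg)) V3 M2"
          "exp_ok B (Bin Sub (Var size_reg) (Var count_reg)) V3 M2"
          using small V3 V3' size_bounds(2) by (auto simp: exp_ok_def)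
      next
        assume "exp_val (Var count_reg) V3 M2 = exp_val (Var size_reg) V3 M2"
        then have kj: "card (N j) = k" using V3 V3' by simp
        have ins: "insert j (processed k j) = processed k (Suc j)"
          using jn kj by (auto simp: processed_def less_Suc_eq)
        show "wp B K (Seq find_best (Seq relabel update_val)) ?Q V3 M2"
        proof (rule wp_process_state[OF sol3 V3'(1) jn])
          fix V4 M4
          assume "frame {9..<scratch} V3 V4" "solved (insert j (processed k j)) V4 M4"
          then show "?Q V4 M4" using Q fr unfolding ins by blast
        qed (use kj in \<open>auto simp: processed_def\<close>)
      next
        assume "exp_val (Var count_reg) V3 M2 \<noteq> exp_val (Var size_reg) V3 M2"
        then have "card (N j) \<noteq> k" using V3 V3' by simp
        then have "processed k (Suc j) = processed k j"
          by (auto simp: processed_def less_Suc_eq)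
        then have "solved (processed k (Suc j)) V3 M2" using sol3 by simp
        from Q[OF this fr[OF frame_refl]] show "wp B K Skip ?Q V3 M2"
          by (rule wp_Skip[where Q = ?Q])
      qed
    qed
  next
    fix V2 M2
    assume "solved (processed k (nat (V1 n_reg))) V2 M2 \<and> V2 size_reg = int k"
    moreover have "processed k n = processed (Suc k) 0" by (auto simp: processed_def)
    moreover have "V2 sizes_reg = V sizes_reg" if "regs V2" using that V by (simp add: regs_def)
    ultimately show "solved (processed (Suc k) 0) (V2(size_reg := int (Suc k))) M2 \<and>
        V2 size_reg = int k \<and> V2 sizes_reg = V sizes_reg"
      using V1n solved_frame[of "processed k n" V2 M2 "{size_reg}"] frame_upd[OF frame_refl]
      by (simp add: solved_def)
  qed (use size_bounds in auto)
next
  fix V1 M1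
  have V: "V sizes_reg = int m + 1" using sol by (simp add: solved_def regs_def)
  assume "solved (processed (nat (V sizes_reg)) 0) V1 M1"
  moreover have "processed (Suc m) 0 = {..<n}"
    using N(1) card_mono[of "{..<m}"] by (auto simp: processed_def less_Suc_eq_le)
  ultimately show "Q V1 M1" using Q V by (simp add: nat_add_distrib)
qed (use size_bounds in auto)

lemma work_mem_low: "work_mem rep val M \<Longrightarrow> a < 2 * m \<Longrightarrow> work_mem rep val (M(a := x))"
  unfolding work_mem_def base_def by auto

text \<open>The input is no longer tracked from here on, since the output may overwrite it; only the
  arrays for \<open>rep\<close> and \<open>val\<close> are still read.\<close>

lemma wp_write_output:
  assumes V: "regs V" and M: "work_mem rep val M" and rep: "\<And>\<sigma>. \<sigma> < m \<Longrightarrow> rep \<sigma> \<le> m"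
    and Q: "\<And>V' M'. V' 0 = 2 * int m \<Longrightarrow>
      (\<And>\<sigma>. \<sigma> < m \<Longrightarrow> M' (2 * \<sigma>) = of_bool (val (rep \<sigma>) > 0) \<and> M' (Suc (2 * \<sigma>)) = 1) \<Longrightarrow> Q V' M'"
  shows "wp B K write_output Q V M"
  unfolding write_output_def
proof (rule wp_Seq)
  let ?X = "{signal_reg, rep_reg}"
  let ?I = "\<lambda>j V' M'. frame ?X V V' \<and> work_mem rep val M' \<and>
    (\<forall>\<sigma><j. M' (2 * \<sigma>) = of_bool (val (rep \<sigma>) > 0) \<and> M' (Suc (2 * \<sigma>)) = 1)"
  let ?a = "Bin Mul (Num 2) (Var signal_reg)"
  let ?b = "Bin Add (Num 1) ?a"
  have Vm: "V m_reg = int m" using V by (simp add: regs_def)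
  show "wp B K (for_upto signal_reg m_reg
       (Seq (assign rep_reg (Mem (rep_addr signal_reg)))
         (Seq (if_pos (Mem (val_addr rep_reg)) (mem_write ?a (Num 1)) (mem_write ?a (Num 0)))
           (mem_write ?b (Num 1)))))
     (wp B K (assign 0 (Bin Mul (Num 2) (Var m_reg))) Q) V M"
  proof (rule wp_for_upto[where Inv = ?I])
    fix j V' M'
    assume j: "j < nat (V m_reg)" and I: "?I j V' M'" and *: "V' signal_reg = int j" "V' m_reg = V m_reg"
    let ?Q = "\<lambda>V'' M''. ?I (Suc j) (V''(signal_reg := int (Suc j))) M'' \<and>
      V'' signal_reg = int j \<and> V'' m_reg = V m_reg"
    have jm: "j < m" using j Vm by simp
    have V': "regs V'" using regs_frame[OF V, of _ V'] I by auto
    have M': "work_mem rep val M'" using I by simp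
    note R = exp_val_rep[OF V' M' *(1) jm] exp_val_rep_addr[OF V' *(1)]
    define V1 where "V1 = V'(rep_reg := int (rep j))"
    have V1: "regs V1" "V1 signal_reg = int j" "V1 rep_reg = int (rep j)" "V1 m_reg = int m" "frame ?X V V1"
      using V' * I Vm by (auto simp: V1_def regs_def intro!: frame_upd)
    note L1 = exp_val_val[OF V1(1) M' V1(3) rep[OF jm]] exp_val_val_addr[OF V1(1,3) rep[OF jm]]
    have "int base \<le> B" "int j < int m" using size_bounds jm by linarith+
    then have small: "50 \<le> B" "2 * int j + 1 \<le> B" using size_bounds by linarith+
    have second: "wp B K (mem_write ?b (Num 1)) ?Q V1 (M'(2 * j := of_bool (val (rep j) > 0)))"
    proof (rule wp_mem_write)
      have addr: "nat (exp_val ?b V1 M0) = Suc (2 * j)" for M0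
        using V1 by (simp add: nat_add_distrib nat_mult_distrib)
      have "work_mem rep val (M'(2 * j := x, Suc (2 * j) := y))" for x y
        by (intro work_mem_low M') (use jm in auto)
      moreover have "(M'(2 * j := x, Suc (2 * j) := y)) a = M' a" if "a < 2 * j" for x y a
        using that by simp
      ultimately show "?Q V1 ((M'(2 * j := of_bool (val (rep j) > 0)))
          (nat (exp_val ?b V1 (M'(2 * j := of_bool (val (rep j) > 0)))) :=
             exp_val (Num 1) V1 (M'(2 * j := of_bool (val (rep j) > 0)))))"
        using V1 I Vm unfolding addr by (auto simp: less_Suc_eq intro!: frame_upd)
    qed (use V1 small in \<open>auto simp: exp_ok_def\<close>)
    have first: "wp B K (if_pos (Mem (val_addr rep_reg)) (mem_write ?a (Num 1)) (mem_write ?a (Num 0)))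
        (wp B K (mem_write ?b (Num 1)) ?Q) V1 M'"
    proof (rule wp_if_pos)
      have addr: "nat (exp_val ?a V1 M') = 2 * j" using V1 by (simp add: nat_mult_distrib)
      have ok: "exp_ok B ?a V1 M'" "exp_ok B (Num 1) V1 M'" "exp_ok B (Num 0) V1 M'" "0 \<le> exp_val ?a V1 M'"
        using V1 small by (auto simp: exp_ok_def)
      show "exp_ok B (Mem (val_addr rep_reg)) V1 M'"
        using L1 small by (simp add: exp_ok_def)
      show "wp B K (mem_write ?a (Num 1)) (wp B K (mem_write ?b (Num 1)) ?Q) V1 M'"
        if "0 < exp_val (Mem (val_addr rep_reg)) V1 M'"
        by (rule wp_mem_write[OF ok(1,2,4)]) (use that L1 second addr in simp)
      show "wp B K (mem_write ?a (Num 0)) (wp B K (mem_write ?b (Num 1)) ?Q) V1 M'"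
        if "exp_val (Mem (val_addr rep_reg)) V1 M' \<le> 0"
        by (rule wp_mem_write[OF ok(1,3,4)]) (use that L1 second addr in simp)
    qed
    show "wp B K (Seq (assign rep_reg (Mem (rep_addr signal_reg)))
         (Seq (if_pos (Mem (val_addr rep_reg)) (mem_write ?a (Num 1)) (mem_write ?a (Num 0)))
           (mem_write ?b (Num 1)))) ?Q V' M'"
      by (rule wp_Seq, rule wp_assign, rule_tac [3] wp_Seq)
        (use first R jm small in \<open>auto simp: exp_ok_def V1_def\<close>)
  next
    fix V' M' assume I: "?I (nat (V m_reg)) V' M'"
    have "V' m_reg = int m" using I Vm by (auto simp: frame_def)
    moreover have "2 * int m \<le> B" using size_bounds by linarith
    ultimately show "wp B K (assign 0 (Bin Mul (Num 2) (Var m_reg))) Q V' M'"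
      using I Vm size_bounds(2) by (intro wp_assign Q) (auto simp: exp_ok_def)
  qed (use Vm M size_bounds in \<open>auto intro!: frame_upd frame_refl\<close>)
qed

lemma wp_delegation_program:
  assumes V: "V 0 = int (2 + 3 * n + n * m)"
    and M: "input_mem M" "\<And>a. 2 + 3 * n + n * m \<le> a \<Longrightarrow> M a = 0"
    and Q: "\<And>V' M' c rep val. V' 0 = 2 * int m \<Longrightarrow> val m \<le> 0 \<Longrightarrow>
      best_schemes n m N w {..<n} c rep val \<Longrightarrow>
      (\<And>\<sigma>. \<sigma> < m \<Longrightarrow> M' (2 * \<sigma>) = of_bool (val (rep \<sigma>) > 0) \<and> M' (Suc (2 * \<sigma>)) = 1) \<Longrightarrow> Q V' M'"
  shows "wp B K delegation_program Q V M"
proof -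
  define V1 where "V1 = V(n_reg := int n)"
  define V2 where "V2 = V1(m_reg := int m)"
  define V3 where "V3 = V2(base_reg := int base)"
  define V4 where "V4 = V3(sizes_reg := int m + 1)"
  have main: "wp B K (Seq common_denominator (Seq init_schemes (Seq process_states write_output))) Q V4 M"
  proof (rule wp_Seq, rule wp_common_denominator)
    show "V4 n_reg = int n" by (simp add: V4_def V3_def V2_def V1_def)
    fix V5 assume V5: "frame {denom_reg, state_reg} V4 V5" "V5 denom_reg = D"
    have regs: "regs V5"
      using V5 unfolding regs_def frame_def by (simp add: V4_def V3_def V2_def V1_def)
    show "wp B K (Seq init_schemes (Seq process_states write_output)) Q V5 M"
    proof (rule wp_Seq, rule wp_init_schemes[OF regs M(1)])
      fix V6 M6
      assume V6: "frame {signal_reg} V5 V6" and M6: "input_mem M6"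
        "work_mem (\<lambda>\<sigma>. \<sigma>) ((\<lambda>_. 0)(m := - 1 - D)) M6"
      have "best_schemes n m N w {} (\<lambda>\<sigma>. \<sigma>) (\<lambda>\<sigma>. \<sigma>) (\<lambda>_. 0)"
        by (rule best_schemes_init[OF N(1)])
      then have "best_schemes n m N w {} (\<lambda>\<sigma>. \<sigma>) (\<lambda>\<sigma>. \<sigma>) ((\<lambda>_. 0)(m := - 1 - D))"
        by (rule best_schemes_cong) (use N(1) in auto)
      then have sol: "solved {} V6 M6"
        unfolding solved_def using regs_frame[OF regs V6] M6 by fastforce
      show "wp B K (Seq process_states write_output) Q V6 M6"
      proof (rule wp_Seq, rule wp_process_states[OF sol])
        fix V7 M7 assume "solved {..<n} V7 M7"
        then obtain c rep val where *: "regs V7" "work_mem rep val M7" "val m = - 1 - D"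
            and inv: "best_schemes n m N w {..<n} c rep val"
          unfolding solved_def by blast
        have "rep \<sigma> \<le> m" if "\<sigma> < m" for \<sigma> using best_schemesD(1,4)[OF inv that] by auto
        moreover have "val m \<le> 0" using *(3) D_bounds by simp
        ultimately show "wp B K write_output Q V7 M7"
          using Q[OF _ _ inv] by (intro wp_write_output[OF *(1,2)]) auto
      qed
    qed (use M in \<open>auto simp: base_def\<close>)
  qed (use M in auto)
  have small: "2 * int m \<le> B" "int base \<le> B" "int m + 1 \<le> B" "50 \<le> B" using size_bounds by linarith+
  \<comment> \<open>Register 0 initially holds the length of the input, so the program obtains
    \<open>base\<close> from it by adding \<open>2 * m\<close>.\<close>
  have len: "V 0 + 2 * int m = int base" using V by (simp add: base_def)
  have "wp B K (Seq (assign sizes_reg (Bin Add (Var m_reg) (Num 1)))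
    (Seq common_denominator (Seq init_schemes (Seq process_states write_output)))) Q V3 M"
    by (rule wp_Seq, rule wp_assign)
      (use main small in \<open>auto simp: exp_ok_def V4_def V3_def V2_def\<close>)
  then have "wp B K (Seq (assign base_reg (Bin Add (Var 0) (Bin Mul (Num 2) (Var m_reg))))
    (Seq (assign sizes_reg (Bin Add (Var m_reg) (Num 1)))
    (Seq common_denominator (Seq init_schemes (Seq process_states write_output))))) Q V2 M"
    by (intro wp_Seq[of _ _ "assign base_reg e" for e] wp_assign)
      (use small len in \<open>auto simp: exp_ok_def V3_def V2_def V1_def\<close>)
  then have "wp B K (Seq (assign m_reg (Mem (Num 1)))
    (Seq (assign base_reg (Bin Add (Var 0) (Bin Mul (Num 2) (Var m_reg))))
    (Seq (assign sizes_reg (Bin Add (Var m_reg) (Num 1)))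
    (Seq common_denominator (Seq init_schemes (Seq process_states write_output)))))) Q V1 M"
    by (intro wp_Seq[of _ _ "assign m_reg e" for e] wp_assign)
      (use small M in \<open>auto simp: exp_ok_def V2_def input_mem_def\<close>)
  then show ?thesis
    unfolding delegation_program_def
    by (intro wp_Seq[of _ _ "assign n_reg e" for e] wp_assign)
      (use small M in \<open>auto simp: exp_ok_def V1_def input_mem_def\<close>)
qed

end


section \<open>Encoded instances\<close>

lemma less_two_power_bits: "\<bar>x\<bar> < 2 ^ bits x"
proof (cases "x = 0")
  case False
  then have "nat \<bar>x\<bar> < 2 ^ floorlog 2 (nat \<bar>x\<bar>)"
    using floorlog_bounds[of "nat \<bar>x\<bar>" 2] by simp
  then have "\<bar>x\<bar> < 2 ^ floorlog 2 (nat \<bar>x\<bar>)"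
    by (metis nat_less_numeral_power_cancel_iff)
  also have "(2 :: int) ^ floorlog 2 (nat \<bar>x\<bar>) \<le> 2 ^ bits x"
    by (simp add: bits_def)
  finally show ?thesis .
qed simp

lemma length_le_input_size: "length xs \<le> input_size xs"
  by (induction xs) (auto simp: input_size_def bits_def)

lemma input_size_append: "input_size (xs @ ys) = input_size xs + input_size ys"
  by (simp add: input_size_def)

lemma bits_le_input_size: "x \<in> set xs \<Longrightarrow> bits x \<le> input_size xs"
  unfolding input_size_def by (rule member_le_sum_list) auto

lemma nth_concat_rows:
  assumes "\<And>i. length (f i) = k" "i < n" "j < k"
  shows "concat (map f [0..<n]) ! (i * k + j) = f i ! j"
  using assms(2)
proof (induction n)
  case (Suc n)
  have len: "length (concat (map f [0..<n])) = n * k"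
    using assms(1) by (simp add: length_concat comp_def sum_list_triv)
  show ?case
  proof (cases "i = n")
    case True then show ?thesis using len by (simp add: nth_append)
  next
    case False
    then have "i < n" using Suc.prems by simp
    moreover from this have "i * k + j < n * k"
      using assms(3) by (rule row_index_less)
    ultimately show ?thesis using Suc.IH len by (simp add: nth_append)
  qed
qed simp

lemma length_concat_rows: "(\<And>i. length (f i) = k) \<Longrightarrow> length (concat (map f [0..<n])) = n * k"
  by (simp add: length_concat comp_def sum_list_triv)


text \<open>Applied to the denominators: their product has at most as many bits as their encodings
  together, hence linear bit length.\<close>

lemma sum_bits_le_input_size:
  "(\<Sum>\<theta><n. bits (h \<theta>)) \<le> input_size (concat (map f [0..<n]))" if "\<And>\<theta>. h \<theta> \<in> set (f \<theta>)"
proof (induction n)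
  case (Suc n)
  then show ?case using bits_le_input_size[OF that[of n]] by (simp add: input_size_append)
qed simp

lemma wp_exec:
  assumes "wp B K c Q V M" "bounded B V M"
  obtains t R' V' M' where "exec c (V, M) t (R', M')" "t \<le> steps K c * (6 * bits B)"
    "\<And>i. i < scratch \<Longrightarrow> R' i = V' i" "Q V' M'"
  by (rule wpD[OF assms refl]) (use that in \<open>auto simp: runs_def\<close>)

lemma encode_rat_eq: "encode_rat r = [fst (quotient_of r), snd (quotient_of r)]"
  by (simp add: encode_rat_def split: prod.splits)

lemma encode_rat_of_bool: "encode_rat (of_bool b) = [of_bool b, 1]"
  by (simp add: encode_rat_eq)

lemma map_upt_double:
  assumes "\<And>\<sigma>. \<sigma> < m \<Longrightarrow> [M (2 * \<sigma>), M (Suc (2 * \<sigma>))] = f \<sigma>"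
  shows "map M [0..<2 * m] = concat (map f [0..<m])"
  using assms by (induction m) auto

section \<open>Instances as integer data\<close>

context
  fixes I :: "(nat, nat) delegation" and n m :: nat
  assumes inst: "delegation_instance I" and numb: "numbered I"
    and n_def: "n = card (states I)" and m_def: "m = card (signals I)"
begin

lemma states_eq: "states I = {..<n}" and signals_eq: "signals I = {..<m}"
  using numb by (auto simp: numbered_def n_def m_def)

lemma nbhd_subset: "nbhd I \<theta> \<subseteq> {..<m}"
  using inst signals_eq by (auto simp: delegation_instance_def nbhd_def)

lemma nbhd_nonempty: "\<theta> < n \<Longrightarrow> nbhd I \<theta> \<noteq> {}"
  using inst states_eq by (auto simp: delegation_instance_def nbhd_def)

text \<open>Without states the probabilities would sum to 0. A nonempty adjacency matrix is what
  bounds the number of signals by the input size.\<close>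

lemma n_pos: "0 < n"
  using inst states_eq by (cases n) (auto simp: delegation_instance_def)

definition pnum :: "nat \<Rightarrow> int" where "pnum \<theta> = fst (quotient_of (prob I \<theta>))"
definition pden :: "nat \<Rightarrow> int" where "pden \<theta> = snd (quotient_of (prob I \<theta>))"

lemma pden_pos: "0 < pden \<theta>"
  by (simp add: pden_def quotient_of_denom_pos')

lemma prob_eq: "prob I \<theta> = of_int (pnum \<theta>) / of_int (pden \<theta>)"
  by (rule quotient_of_div) (simp add: pnum_def pden_def)

lemma pnum_pos: "\<theta> < n \<Longrightarrow> 0 < pnum \<theta>"
proof -
  assume "\<theta> < n"
  then have "0 < prob I \<theta>" using inst states_eq by (auto simp: delegation_instance_def)
  then show ?thesis using pden_pos[of \<theta>] by (simp add: prob_eq zero_less_divide_iff)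
qed

text \<open>The product contains the denominator of \<theta> as a factor, so the integer division
  loses nothing.\<close>

lemma scaled_prob:
  assumes "\<theta> < n"
  shows "of_int (pnum \<theta> * ((\<Prod>\<eta><n. pden \<eta>) div pden \<theta>)) = of_int (\<Prod>\<eta><n. pden \<eta>) * prob I \<theta>"
proof -
  have "pden \<theta> dvd (\<Prod>\<eta><n. pden \<eta>)" using assms by (intro dvd_prodI) auto
  then obtain k where "(\<Prod>\<eta><n. pden \<eta>) = pden \<theta> * k" by blast
  then show ?thesis using pden_pos[of \<theta>] by (simp add: prob_eq)
qed

lemma scaled_prob_sum:
  "(\<Sum>\<theta><n. pnum \<theta> * ((\<Prod>\<eta><n. pden \<eta>) div pden \<theta>)) = (\<Prod>\<eta><n. pden \<eta>)"
proof -
  have "(of_int (\<Sum>\<theta><n. pnum \<theta> * ((\<Prod>\<eta><n. pden \<eta>) div pden \<theta>)) :: rat) =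
      (\<Sum>\<theta><n. of_int (\<Prod>\<eta><n. pden \<eta>) * prob I \<theta>)"
    unfolding of_int_sum by (rule sum.cong) (use scaled_prob in auto)
  also have "\<dots> = of_int (\<Prod>\<eta><n. pden \<eta>) * (\<Sum>\<theta>\<in>states I. prob I \<theta>)"
    by (simp add: sum_distrib_left states_eq)
  also have "\<dots> = of_int (\<Prod>\<eta><n. pden \<eta>)"
    using inst by (simp add: delegation_instance_def)
  finally show ?thesis by (simp only: of_int_eq_iff)
qed

lemma encode_instance_eq:
  "encode_instance I = [int n, int m] @
     concat (map (\<lambda>\<theta>. [of_bool (\<theta> \<in> acceptable I), pnum \<theta>, pden \<theta>]) [0..<n]) @
     concat (map (\<lambda>\<theta>. map (\<lambda>\<sigma>. of_bool (\<sigma> \<in> nbhd I \<theta>)) [0..<m]) [0..<n])"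
  by (simp add: encode_instance_def n_def[symmetric] m_def[symmetric] Let_def encode_rat_eq
      pnum_def pden_def nbhd_def)

lemma length_encode_instance: "length (encode_instance I) = 2 + 3 * n + n * m"
  by (simp add: encode_instance_eq length_concat_rows[where k = 3] length_concat_rows[where k = m])

lemma encode_instance_nth_state:
  assumes "\<theta> < n" "j < 3"
  shows "encode_instance I ! (2 + j + 3 * \<theta>) = [of_bool (\<theta> \<in> acceptable I), pnum \<theta>, pden \<theta>] ! j"
proof -
  let ?f = "\<lambda>\<theta>. [of_bool (\<theta> \<in> acceptable I), pnum \<theta>, pden \<theta>]"
  have "\<theta> * 3 + j < n * 3" using assms by simp
  then have "encode_instance I ! (2 + (\<theta> * 3 + j)) = concat (map ?f [0..<n]) ! (\<theta> * 3 + j)"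
    by (simp add: encode_instance_eq nth_append length_concat_rows[where k = 3])
  also have "\<dots> = ?f \<theta> ! j" by (rule nth_concat_rows) (use assms in auto)
  finally show ?thesis by (simp add: algebra_simps)
qed

lemma encode_instance_nth_edge:
  assumes "\<theta> < n" "\<sigma> < m"
  shows "encode_instance I ! (2 + 3 * n + (\<theta> * m + \<sigma>)) = of_bool (\<sigma> \<in> nbhd I \<theta>)"
proof -
  let ?g = "\<lambda>\<theta>. map (\<lambda>\<sigma>. of_bool (\<sigma> \<in> nbhd I \<theta>) :: int) [0..<m]"
  have "encode_instance I ! (2 + (n * 3 + (\<theta> * m + \<sigma>))) = concat (map ?g [0..<n]) ! (\<theta> * m + \<sigma>)"
    by (simp add: encode_instance_eq nth_append length_concat_rows[where k = 3])
  also have "\<dots> = ?g \<theta> ! \<sigma>" by (rule nth_concat_rows) (use assms in auto)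
  finally show ?thesis using assms by (simp add: algebra_simps)
qed

text \<open>The constant is the utility of always rejecting; the signed sum is what the algorithm
  maximises.\<close>

lemma receiver_utility_eq:
  "receiver_utility I \<psi> = (\<Sum>\<theta>\<in>rejectable I. of_rat (prob I \<theta>)) +
     (\<Sum>\<theta><n. (if \<theta> \<in> acceptable I then 1 else - 1) * of_rat (prob I \<theta>) * Max (\<psi> ` nbhd I \<theta>))"
proof -
  have fin: "finite (acceptable I)" "finite (rejectable I)" and disj: "acceptable I \<inter> rejectable I = {}"
    using inst by (auto simp: delegation_instance_def states_def)
  let ?h = "\<lambda>\<theta>. (if \<theta> \<in> acceptable I then 1 else - 1) * of_rat (prob I \<theta>) * Max (\<psi> ` nbhd I \<theta>)"
  have "(\<Sum>\<theta><n. ?h \<theta>) = sum ?h (acceptable I) + sum ?h (rejectable I)"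
    unfolding states_eq[symmetric] states_def by (rule sum.union_disjoint[OF fin disj])
  also have "sum ?h (rejectable I) = (\<Sum>\<theta>\<in>rejectable I. - (of_rat (prob I \<theta>) * Max (\<psi> ` nbhd I \<theta>)))"
    by (rule sum.cong) (use disj in auto)
  finally show ?thesis
    by (simp add: receiver_utility_def algebra_simps sum_subtractf sum_negf)
qed

lemma delegation_program_correct:
  assumes lam: "laminar (nbhd I ` states I)"
  defines "S \<equiv> input_size (encode_instance I)"
  shows "\<exists>t s. exec delegation_program (input_state (encode_instance I)) t s \<and>
    t \<le> steps S delegation_program * (6 * (S + 12)) \<and> encodes_optimal_scheme I (output_of s)"
proof -
  \<comment> \<open>With \<open>T = 2 ^ S\<close>, the input length and every input entry are below
    \<open>T\<close>, and the product of the denominators is at most \<open>T\<close>. The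
    requirements on \<open>B\<close> then amount to at most \<open>70 * T\<close> and
    \<open>14 * T\<close>, for which the factor 1024 leaves room.\<close>
  define B :: int where "B = 2 ^ (S + 10)"
  have bits_B: "bits B = S + 12"
    by (simp add: bits_def B_def nat_power_eq floorlog_def log_nat_power del: power_Suc)
  have S_ge: "2 + 3 * n + n * m \<le> S"
    using length_le_input_size[of "encode_instance I"] by (simp add: length_encode_instance S_def)
  define T :: int where "T = 2 ^ S"
  have T: "int S < T" "1 \<le> T" by (simp_all add: T_def)
  have B_eq: "B = 1024 * T" by (simp add: B_def T_def power_add)
  have "(\<Prod>\<theta><n. pden \<theta>) \<le> (\<Prod>\<theta><n. 2 ^ bits (pden \<theta>))"
  proof (rule prod_mono)
    fix \<theta> show "0 \<le> pden \<theta> \<and> pden \<theta> \<le> 2 ^ bits (pden \<theta>)"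
      using pden_pos[of \<theta>] less_two_power_bits[of "pden \<theta>"] by linarith
  qed
  also have "\<dots> = 2 ^ (\<Sum>\<theta><n. bits (pden \<theta>))" by (simp add: power_sum)
  also have "\<dots> \<le> T"
    unfolding T_def
  proof (rule power_increasing)
    have "(\<Sum>\<theta><n. bits (pden \<theta>)) \<le>
        input_size (concat (map (\<lambda>\<theta>. [of_bool (\<theta> \<in> acceptable I), pnum \<theta>, pden \<theta>]) [0..<n]))"
      by (rule sum_bits_le_input_size) simp
    also have "\<dots> \<le> S"
      unfolding S_def encode_instance_eq input_size_append by simp
    finally show "(\<Sum>\<theta><n. bits (pden \<theta>)) \<le> S" .
  qed simp
  finally have D_le: "(\<Prod>\<theta><n. pden \<theta>) \<le> T" .
  have "m < n * m + 2" using n_pos by (cases n) auto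
  then have m_less: "m < S" using S_ge by linarith
  interpret delegation_data n m "nbhd I" "\<lambda>\<theta>. \<theta> \<in> acceptable I" pnum pden B S
  proof
    show "nbhd I \<theta> \<subseteq> {..<m}" for \<theta> by (rule nbhd_subset)
    show "laminar (nbhd I ` {..<n})" using lam states_eq by simp
    show "n \<le> S" using S_ge by linarith
    have "int (2 + 3 * n + n * m) \<le> int S" using S_ge by (rule of_nat_mono)
    moreover have "10 * s + 10 * x + 50 \<le> B" if "x \<le> s" "s < T" for s x
      unfolding B_eq using that T(2) by linarith
    ultimately show "10 * int S + 10 * int (2 + 3 * n + n * m) + 50 \<le> B"
      using T(1) by blast
    show "4 * (\<Prod>\<theta><n. pden \<theta>) + 10 \<le> B"
      unfolding B_eq using D_le T by linarith
  qed (use nbhd_nonempty pden_pos pnum_pos m_less scaled_prob_sum in auto)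
  define V where "V = fst (input_state (encode_instance I))"
  define M where "M = snd (input_state (encode_instance I))"
  have V0: "V 0 = int (2 + 3 * n + n * m)"
    by (simp add: V_def input_state_def length_encode_instance)
  have M_eq: "M a = (if a < 2 + 3 * n + n * m then encode_instance I ! a else 0)" for a
    by (simp add: M_def input_state_def length_encode_instance)
  have input: "input_mem M"
    unfolding input_mem_def
  proof (intro conjI allI impI)
    show "M 0 = int n" "M 1 = int m" by (simp_all add: M_eq encode_instance_eq)
    fix \<theta> assume "\<theta> < n"
    then show "M (2 + 3 * \<theta>) = of_bool (\<theta> \<in> acceptable I)" "M (3 + 3 * \<theta>) = pnum \<theta>" "M (4 + 3 * \<theta>) = pden \<theta>"
      using encode_instance_nth_state[of \<theta> 0] encode_instance_nth_state[of \<theta> 1]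
        encode_instance_nth_state[of \<theta> 2] by (simp_all add: M_eq)
    fix \<sigma> assume "\<sigma> < m"
    then show "M (2 + 3 * n + (\<theta> * m + \<sigma>)) = of_bool (\<sigma> \<in> nbhd I \<theta>)"
      using encode_instance_nth_edge[OF \<open>\<theta> < n\<close>] row_index_less[OF \<open>\<theta> < n\<close>] by (simp add: M_eq)
  qed
  have bounded: "bounded B V M"
  proof -
    have "int (2 + 3 * n + n * m) \<le> B" using S_ge T unfolding B_eq by linarith
    then have "\<bar>V i\<bar> \<le> B" for i
      using T(2) unfolding V_def input_state_def B_eq by (simp add: length_encode_instance)
    moreover have "\<bar>M a\<bar> \<le> B" for a
    proof (cases "a < 2 + 3 * n + n * m")
      case True
      then have "encode_instance I ! a \<in> set (encode_instance I)"
        by (intro nth_mem) (simp add: length_encode_instance)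
      then have "(2 :: int) ^ bits (encode_instance I ! a) \<le> T"
        unfolding S_def T_def by (intro power_increasing bits_le_input_size) auto
      then show ?thesis
        using less_two_power_bits[of "encode_instance I ! a"] True unfolding M_eq B_eq by simp
    qed (use T(2) in \<open>simp add: M_eq B_eq\<close>)
    ultimately show ?thesis by (simp add: bounded_def)
  qed
  define Q where "Q V' M' \<longleftrightarrow> V' 0 = 2 * int m \<and> (\<exists>c rep val. val m \<le> 0 \<and>
      best_schemes n m (nbhd I) w {..<n} c rep val \<and>
      (\<forall>\<sigma><m. M' (2 * \<sigma>) = of_bool (val (rep \<sigma>) > 0) \<and> M' (Suc (2 * \<sigma>)) = 1))" for V' M' :: store
  have "wp B S delegation_program Q V M"
    by (rule wp_delegation_program) (use V0 input in \<open>auto simp: M_eq Q_def\<close>)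
  then obtain t R' V' M' where run: "exec delegation_program (V, M) t (R', M')"
      and t: "t \<le> steps S delegation_program * (6 * bits B)"
      and R': "R' 0 = V' 0" and "Q V' M'"
    by (rule wp_exec[OF _ bounded]) auto
  then obtain c rep val where V': "V' 0 = 2 * int m" and val: "val m \<le> 0"
    and best: "best_schemes n m (nbhd I) w {..<n} c rep val"
    and M': "\<And>\<sigma>. \<sigma> < m \<Longrightarrow> M' (2 * \<sigma>) = of_bool (val (rep \<sigma>) > 0) \<and> M' (Suc (2 * \<sigma>)) = 1"
    unfolding Q_def by blast
  define \<psi> :: "nat \<Rightarrow> rat" where "\<psi> \<sigma> = of_bool (val (rep \<sigma>) > 0)" for \<sigma>
  have scheme: "(\<lambda>\<sigma>. of_rat (\<psi> \<sigma>) :: real) = (\<lambda>\<sigma>. of_bool (val (rep \<sigma>) > 0))"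
    by (auto simp: \<psi>_def)
  have w_eq: "real_of_int (w \<theta>) = of_int D * ((if \<theta> \<in> acceptable I then 1 else - 1) * of_rat (prob I \<theta>))"
    if "\<theta> < n" for \<theta>
  proof -
    have "real_of_int (mag \<theta>) = of_rat (of_int (mag \<theta>))" by simp
    also have "\<dots> = of_int D * of_rat (prob I \<theta>)"
      unfolding mag_def D_def scaled_prob[OF that] by (simp only: of_rat_mult of_rat_of_int_eq)
    finally show ?thesis by (simp add: w_def)
  qed
  \<comment> \<open>\<open>D\<close> is positive and the first summand does not depend on the
    scheme, so comparing utilities is comparing the integer-weighted sums.\<close>
  have scaled: "of_int D * receiver_utility I \<phi> = of_int D * (\<Sum>\<theta>\<in>rejectable I. of_rat (prob I \<theta>)) +
      (\<Sum>\<theta><n. w \<theta> * Max (\<phi> ` nbhd I \<theta>))" for \<phi> :: "nat \<Rightarrow> real"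
    unfolding receiver_utility_eq distrib_left sum_distrib_left[of _ _ "{..<n}"]
    by (intro arg_cong2[where f = "(+)"] sum.cong refl) (simp add: w_eq)
  have "receiver_utility I \<phi> \<le> receiver_utility I (\<lambda>\<sigma>. of_rat (\<psi> \<sigma>))" if "decision_scheme I \<phi>" for \<phi>
  proof -
    have "(\<Sum>\<theta><n. w \<theta> * Max (\<phi> ` nbhd I \<theta>)) \<le>
        (\<Sum>\<theta><n. w \<theta> * (MAX \<sigma>\<in>nbhd I \<theta>. of_bool (val (rep \<sigma>) > 0) :: real))"
      by (rule best_schemes_optimal[OF best val N])
        (use that signals_eq in \<open>auto simp: decision_scheme_def\<close>)
    then have "of_int D * receiver_utility I \<phi> \<le> of_int D * receiver_utility I (\<lambda>\<sigma>. of_rat (\<psi> \<sigma>))"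
      by (simp add: scaled scheme)
    then show ?thesis using D_bounds(1) by simp
  qed
  moreover have "decision_scheme I (\<lambda>\<sigma>. of_rat (\<psi> \<sigma>))"
    by (simp add: decision_scheme_def scheme)
  ultimately have opt: "optimal_scheme I (\<lambda>\<sigma>. of_rat (\<psi> \<sigma>))"
    by (simp add: optimal_scheme_def)
  have "nat (R' 0) = 2 * m" using R' V' by simp
  then have "output_of (R', M') = map M' [0..<2 * m]" by (simp add: output_of_def)
  also have "\<dots> = encode_scheme I \<psi>"
    unfolding encode_scheme_def m_def[symmetric]
    by (rule map_upt_double) (simp add: M' \<psi>_def encode_rat_of_bool)
  finally have "encodes_optimal_scheme I (output_of (R', M'))"
    using opt by (auto simp: encodes_optimal_scheme_def)
  moreover have "input_state (encode_instance I) = (V, M)" by (simp add: V_def M_def)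
  ultimately show ?thesis using run t unfolding bits_B by metis
qed

end

theorem theorem4p11:
  shows "polytime_solvable
    {I :: (nat, nat) delegation.
       delegation_instance I \<and> laminar (nbhd I ` states I) \<and> numbered I}
    encode_instance
    encodes_optimal_scheme"
proof -
  obtain p where p: "\<And>N. steps N delegation_program = poly p N"
    using steps_poly by blast
  \<comment> \<open>The linear factor is \<open>6 * (S + 12)\<close>, the bound for the cost of one
    instruction, since \<open>B\<close> has bit length \<open>S + 12\<close>.\<close>
  have "poly (p * [:72, 6:]) S = steps S delegation_program * (6 * (S + 12))" for S
    by (simp add: p algebra_simps)
  then show ?thesis
    unfolding polytime_solvable_def
    using delegation_program_correct[OF _ _ refl refl] by (metis (mono_tags, lifting) mem_Collect_eq)
qed

end
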